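(* Let $\mathcal{Z}$ be a well-behaved percolation on $\mathbb{H}^2$ and let $\alpha\ge0$ be its decay exponent. Suppose that $\alpha<1$. Then: (i) almost surely $\mathcal{Z}$ contains hyperbolic lines; (ii) for every fixed $x\in\mathbb{H}^2$, there is a positive probability that $\mathcal{Z}$ contains a half-line containing $x$; and (iii) for every fixed point $x$ in the ideal boundary $\partial\mathbb{H}^2$, there is almost surely a geodesic line passing through $x$ whose intersection with $\mathcal{Z}$ contains a half-line.
   Context: A hyperbolic (geodesic) line is a bi-infinite geodesic and a half-line is an infinite geodesic ray in the hyperbolic plane $\mathbb{H}^2$. A geodesic line passes through a point $x\in\partial\mathbb{H}^2$ of the ideal boundary if $x$ is one of its endpoints at infinity. Fix a closed disk $B\subset\mathbb{H}^2$ of radius $1$. A well-behaved percolation on $\mathbb{H}^2$ is a random closed subset $\mathcal{Z}\subset\mathbb{H}^2$ satisfying: (1) The law of $\mathcal{Z}$ is invariant under isometries of $\mathbb{H}^2$. (2) $\mathcal{Z}$ satisfies positive correlations: for every pair $g,h$ of bounded increasing measurable functions of $\mathcal{Z}$, $\mathbf{E}[g(\mathcal{Z})h(\mathcal{Z})]\ge\mathbf{E}[g(\mathcal{Z})]\,\mathbf{E}[h(\mathcal{Z})]$. (3) There is some $R_0<\infty$ such that $\mathcal{Z}$ satisfies independence at distance $R_0$: for every pair of subsets $A,A'\subset\mathbb{H}^2$ with $\inf\{d(a,a'):a\in A,a'\in A'\}\ge R_0$, the intersections $\mathcal{Z}\cap A$ and $\mathcal{Z}\cap A'$ are independent. (4)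 The expected number $m$ of connected components of $B\setminus\mathcal{Z}$ is finite. (5) The expected length $\ell$ of $B\cap\partial\mathcal{Z}$ is finite. (6) $p_0:=\mathbf{P}[B\subset\mathcal{Z}]>0$. Let $f(r)$ be the probability that a fixed geodesic line segment of length $r$ in $\mathbb{H}^2$ is contained in $\mathcal{Z}$. For a well-behaved $\mathcal{Z}$ there is a unique $\alpha\ge 0$ (depending on the law of $\mathcal{Z}$) for which there is a constant $c>0$ with $c\,e^{-\alpha r}\le f(r)\le e^{-\alpha r}$ for all $r\ge 0$; this $\alpha$ is the decay exponent of $\mathcal{Z}$. *)

theory Defs
  imports "HOL-Probability.Probability"
begin

(* The hyperbolic plane in the Poincare disc model: the open unit disc with the metric of
   constant curvature -1, whose ideal boundary is the unit circle.  The hyperbolic metric induces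
   the Euclidean subspace topology on the disc, so topological notions are taken in complex. *)

definition hplane :: "complex set" where
  "hplane = ball 0 1"

definition ideal_boundary :: "complex set" where
  "ideal_boundary = sphere 0 1"

definition hdist :: "complex \<Rightarrow> complex \<Rightarrow> real" where
  "hdist z w = arcosh (1 + 2 * (cmod (z - w))\<^sup>2 / ((1 - (cmod z)\<^sup>2) * (1 - (cmod w)\<^sup>2)))"

definition hcball :: "complex \<Rightarrow> real \<Rightarrow> complex set" where
  "hcball b r = {z \<in> hplane. hdist b z \<le> r}"

definition hyp_isometry :: "(complex \<Rightarrow> complex) \<Rightarrow> bool" where
  "hyp_isometry \<phi> \<longleftrightarrow> bij_betw \<phi> hplane hplane \<and>
     (\<forall>z\<in>hplane. \<forall>w\<in>hplane. hdist (\<phi> z) (\<phi> w) = hdist z w)"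

definition geodesic_on :: "real set \<Rightarrow> (real \<Rightarrow> complex) \<Rightarrow> bool" where
  "geodesic_on I \<gamma> \<longleftrightarrow> \<gamma> ` I \<subseteq> hplane \<and> (\<forall>s\<in>I. \<forall>t\<in>I. hdist (\<gamma> s) (\<gamma> t) = \<bar>s - t\<bar>)"

definition geodesic_line :: "complex set \<Rightarrow> bool" where
  "geodesic_line L \<longleftrightarrow> (\<exists>\<gamma>. geodesic_on UNIV \<gamma> \<and> L = range \<gamma>)"

definition half_line :: "complex set \<Rightarrow> bool" where
  "half_line H \<longleftrightarrow> (\<exists>\<gamma>. geodesic_on {0..} \<gamma> \<and> H = \<gamma> ` {0..})"

definition geodesic_segment :: "real \<Rightarrow> complex set \<Rightarrow> bool" where
  "geodesic_segment r S \<longleftrightarrow> (\<exists>\<gamma>. geodesic_on {0..r} \<gamma> \<and> S = \<gamma> ` {0..r})"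

definition line_through_ideal :: "complex set \<Rightarrow> complex \<Rightarrow> bool" where
  "line_through_ideal L x \<longleftrightarrow> (\<exists>\<gamma>. geodesic_on UNIV \<gamma> \<and> L = range \<gamma> \<and>
     ((\<gamma> \<longlongrightarrow> x) at_top \<or> (\<gamma> \<longlongrightarrow> x) at_bot))"

(* Length of a subset of the plane: one-dimensional Hausdorff measure of the hyperbolic metric,
   normalised so that a geodesic segment of length r has measure r. *)

definition hdiam :: "complex set \<Rightarrow> ennreal" where
  "hdiam S = (SUP x\<in>S. SUP y\<in>S. ennreal (hdist x y))"

definition hlength :: "complex set \<Rightarrow> ennreal" where
  "hlength S = (SUP \<delta>\<in>{0<..}.
     INF U\<in>{U :: nat \<Rightarrow> complex set.
               S \<subseteq> (\<Union>i. U i) \<and> (\<forall>i. U i \<subseteq> hplane \<and> hdiam (U i) \<le> ennreal \<delta>)}.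
       \<Sum>i. hdiam (U i))"

(* The measurable space of relatively closed subsets of A, with the sigma-algebra generated by the
   hitting events of compact sets.  For A = hplane this is the usual (Effros, or Fell-Borel)
   sigma-algebra on closed subsets of the hyperbolic plane. *)

definition closed_sets :: "complex set \<Rightarrow> complex set measure" where
  "closed_sets A = sigma {F. closedin (top_of_set A) F}
     {{F. closedin (top_of_set A) F \<and> F \<inter> K \<noteq> {}} | K. compact K \<and> K \<subseteq> A}"

(* B is the disc hcball b 1.  On B, the frontier in complex of a relatively closed subset of the
   disc is its frontier in the hyperbolic plane.  The integrands of the last two integrals are
   measurable functions of Z. *)

locale well_behaved_percolation = prob_space M
  for M :: "'w measure" and Z :: "'w \<Rightarrow> complex set" and b :: complex +
  assumes centre: "b \<in> hplane"
    and random_closed_set: "Z \<in> M \<rightarrow>\<^sub>M closed_sets hplane"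
    and isometry_invariant: "\<And>\<phi>. hyp_isometry \<phi> \<Longrightarrow>
      distr M (closed_sets hplane) (\<lambda>\<omega>. \<phi> ` Z \<omega>) = distr M (closed_sets hplane) Z"
    and positive_correlations: "\<And>g h :: complex set \<Rightarrow> real.
      g \<in> borel_measurable (closed_sets hplane) \<Longrightarrow> h \<in> borel_measurable (closed_sets hplane) \<Longrightarrow>
      bounded (g ` space (closed_sets hplane)) \<Longrightarrow> bounded (h ` space (closed_sets hplane)) \<Longrightarrow>
      mono_on (space (closed_sets hplane)) g \<Longrightarrow> mono_on (space (closed_sets hplane)) h \<Longrightarrow>
      expectation (\<lambda>\<omega>. g (Z \<omega>) * h (Z \<omega>))
        \<ge> expectation (\<lambda>\<omega>. g (Z \<omega>)) * expectation (\<lambda>\<omega>. h (Z \<omega>))"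
    and finite_range_dependence: "\<exists>R0 :: real. \<forall>A A'. A \<subseteq> hplane \<longrightarrow> A' \<subseteq> hplane \<longrightarrow>
      (\<forall>a\<in>A. \<forall>a'\<in>A'. R0 \<le> hdist a a') \<longrightarrow>
      indep_var (closed_sets A) (\<lambda>\<omega>. Z \<omega> \<inter> A) (closed_sets A') (\<lambda>\<omega>. Z \<omega> \<inter> A')"
    and disc_in_Z_pos: "0 < prob {\<omega> \<in> space M. hcball b 1 \<subseteq> Z \<omega>}"
    and finite_mean_components:
      "(\<integral>\<^sup>+ \<omega>. emeasure (count_space UNIV) (components (hcball b 1 - Z \<omega>)) \<partial>M) < \<infinity>"
    and finite_mean_length:
      "(\<integral>\<^sup>+ \<omega>. hlength (hcball b 1 \<inter> frontier (Z \<omega>)) \<partial>M) < \<infinity>"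

(* By isometry invariance the probability that a geodesic segment lies in Z depends only on its
   length, so quantifying over all segments of length r is the same as fixing one. *)

definition decay_exponent :: "'w measure \<Rightarrow> ('w \<Rightarrow> complex set) \<Rightarrow> real \<Rightarrow> bool" where
  "decay_exponent M Z \<alpha> \<longleftrightarrow> 0 \<le> \<alpha> \<and>
     (\<exists>c>0. \<forall>r\<ge>0. \<forall>S. geodesic_segment r S \<longrightarrow>
        c * exp (- \<alpha> * r) \<le> measure M {\<omega> \<in> space M. S \<subseteq> Z \<omega>} \<and>
        measure M {\<omega> \<in> space M. S \<subseteq> Z \<omega>} \<le> exp (- \<alpha> * r))"

end

theory Submission
  imports Defs
begin

text \<open>The proof is a second moment argument for a two-parameter family of geodesics. For real \<open>u\<close> and \<open>v\<close>
with \<open>1 + u v > 0\<close>, the image of the imaginary axis of the upper half-plane under the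
Moebius map \<open>z \<mapsto> (z + u) / (1 - v z)\<close> is the geodesic from \<open>-1/v\<close> to \<open>u\<close>. Its arclength
parametrisation starts from the image of \<open>\<i>\<close>, and increasing time runs towards \<open>u\<close>. All the curves
that are needed lie in this family: \<open>v = u\<close> gives rays from \<open>\<i>\<close>, \<open>v = 0\<close> gives the geodesics
with endpoint \<open>\<infinity>\<close>, and \<open>u \<in> [0, 1]\<close>, \<open>v \<in> [1, 2]\<close> gives a set of lines with both ends free.
The distance between two points of the family has a closed form (\<open>hdist_disc_geodesic\<close>), and it
follows (\<open>hdist_disc_geodesic_far\<close>) that the two geodesics are far apart after the time
\<open>ln (1 / \<bar>u - u'\<bar>) + O(1)\<close> in the direction of \<open>u\<close>, and after the time
\<open>ln (1 / \<bar>v - v'\<bar>) + O(1)\<close> in the other direction.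

By independence at a distance, the probability that two long segments of the family are both
contained in the random set exceeds the square of the probability for one of them by a factor
\<open>O(\<bar>u - u'\<bar> powr -\<alpha> * \<bar>v - v'\<bar> powr -\<alpha>)\<close> at most (\<open>prob_two_segments_le\<close>). For \<open>\<alpha> < 1\<close> this
kernel is integrable, so the number of surviving segments over a fine grid of parameters has a
second moment that is comparable to the square of its first moment, and some segment survives with a
probability that does not depend on its length (\<open>some_grid_segment_survives\<close>). The sums over a grid
replace integrals over the parameters. Compactness of the parameter set then produces an infinite
geodesic (\<open>some_geodesic_survives\<close>).

For the rays from a point this is the claim, up to measurability of the event, which uses that every
half-line from the origin of the disc is radial. For the almost sure claims, horocyclic translates of
the family by large distances are far from each other, hence independent, and have the same positive
lower bound for the probability of survival; so almost surely one of the translates contains a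
surviving geodesic (\<open>independent_copies\<close>). For lines with endpoint \<open>x\<close>, the translations fix \<open>x\<close> and
the surviving half-lines point away from \<open>x\<close>.\<close>

section \<open>A two-parameter family of geodesics\<close>

definition cayley :: "complex \<Rightarrow> complex" where
  "cayley z = (z - \<i>) / (z + \<i>)"

text \<open>This is the image of \<open>\<i> * exp (- t)\<close> under \<open>z \<mapsto> (z + u) / (1 - v z)\<close>; it tends to \<open>u\<close> as \<open>t \<rightarrow> \<infinity>\<close>
and to \<open>-1/v\<close> (to \<open>\<infinity>\<close> if \<open>v = 0\<close>) as \<open>t \<rightarrow> -\<infinity>\<close>.\<close>

definition uhp_geodesic :: "real \<Rightarrow> real \<Rightarrow> real \<Rightarrow> complex" where
  "uhp_geodesic u v t = Complex u (exp (- t)) / Complex 1 (- v * exp (- t))"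

text \<open>The parameters \<open>a\<close> and \<open>b\<close> move the family by an isometry of the upper half-plane that fixes \<open>\<infinity>\<close>,
and \<open>\<rho>\<close> rotates the disc, so that the fixed ideal point becomes \<open>\<rho>\<close>.\<close>

definition disc_geodesic :: "complex \<Rightarrow> real \<Rightarrow> real \<Rightarrow> real \<Rightarrow> real \<Rightarrow> real \<Rightarrow> complex" where
  "disc_geodesic \<rho> a b u v t = \<rho> * cayley (of_real a + of_real b * uhp_geodesic u v t)"

lemma cmod_diff_add_i: "(cmod (z + \<i>))\<^sup>2 = (cmod (z - \<i>))\<^sup>2 + 4 * Im z"
  by (simp add: cmod_power2) algebra

lemma uhp_plus_i_nonzero: "0 < Im z \<Longrightarrow> z + \<i> \<noteq> 0"
  by (auto simp: complex_eq_iff)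

lemma one_minus_cayley:
  assumes "0 < Im z" "cmod \<rho> = 1"
  shows "1 - (cmod (\<rho> * cayley z))\<^sup>2 = 4 * Im z / (cmod (z + \<i>))\<^sup>2"
  using uhp_plus_i_nonzero[OF assms(1)] assms(2)
  by (simp add: cayley_def norm_mult norm_divide power_divide diff_divide_eq_iff) (simp add: cmod_diff_add_i)

lemma cayley_in_hplane:
  assumes "0 < Im z" "cmod \<rho> = 1"
  shows "\<rho> * cayley z \<in> hplane"
proof -
  have "0 < 1 - (cmod (\<rho> * cayley z))\<^sup>2"
    unfolding one_minus_cayley[OF assms] using uhp_plus_i_nonzero[OF assms(1)] assms(1) by simp
  then show ?thesis by (simp add: hplane_def abs_square_less_1)
qed

text \<open>The argument of \<open>arcosh\<close> on the right is the one of the upper half-plane metric, so the Cayley map is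
an isometry, and it remains one after a rotation of the disc.\<close>

lemma hdist_cayley:
  assumes z: "0 < Im z" and w: "0 < Im w" and \<rho>: "cmod \<rho> = 1"
  shows "hdist (\<rho> * cayley z) (\<rho> * cayley w) = arcosh (1 + (cmod (z - w))\<^sup>2 / (2 * Im z * Im w))"
proof -
  note nz = uhp_plus_i_nonzero[OF z] uhp_plus_i_nonzero[OF w]
  have "cayley z - cayley w = 2 * \<i> * (z - w) / ((z + \<i>) * (w + \<i>))"
    using nz by (simp add: cayley_def divide_simps) (simp add: algebra_simps)
  then have "cmod (\<rho> * cayley z - \<rho> * cayley w) = 2 * cmod (z - w) / (cmod (z + \<i>) * cmod (w + \<i>))"
    using \<rho> by (simp add: right_diff_distrib[symmetric] norm_mult norm_divide)
  then show ?thesis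
    unfolding hdist_def one_minus_cayley[OF z \<rho>] one_minus_cayley[OF w \<rho>]
    using nz z w by (simp add: power_divide power_mult_distrib mult_ac)
qed

lemma uhp_geodesic_denom_nonzero: "Complex 1 x \<noteq> 0"
  by (simp add: complex_eq_iff)

lemma Im_uhp_geodesic: "Im (uhp_geodesic u v t) = exp (- t) * (1 + u * v) / (1 + (v * exp (- t))\<^sup>2)"
  by (simp add: uhp_geodesic_def Im_divide) (simp add: algebra_simps)

lemma Re_uhp_geodesic: "Re (uhp_geodesic u v t) = (u - v * (exp (- t))\<^sup>2) / (1 + (v * exp (- t))\<^sup>2)"
  by (simp add: uhp_geodesic_def Re_divide power2_eq_square)

lemma Im_uhp_geodesic_pos: "0 < 1 + u * v \<Longrightarrow> 0 < Im (uhp_geodesic u v t)"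
  unfolding Im_uhp_geodesic by (intro divide_pos_pos mult_pos_pos) (auto intro: add_pos_nonneg)

lemma disc_geodesic_in_hplane:
  assumes "cmod \<rho> = 1" "0 < b" "0 < 1 + u * v"
  shows "disc_geodesic \<rho> a b u v t \<in> hplane"
  unfolding disc_geodesic_def using assms Im_uhp_geodesic_pos[OF assms(3)] by (intro cayley_in_hplane) auto

text \<open>Let \<open>g\<close> and \<open>g'\<close> be the Moebius maps \<open>z \<mapsto> (z + u) / (1 - v z)\<close> and \<open>z \<mapsto> (z + u') / (1 - v' z)\<close> of
the two geodesics. The map \<open>g\<^sup>-\<^sup>1 \<circ> g'\<close> has the matrix with rows \<open>(1 + u v', u' - u)\<close> and
\<open>(v - v', 1 + u' v)\<close> and the determinant \<open>(1 + u v) (1 + u' v')\<close>. Inserting the determinant cancels the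
mixed terms of \<open>1 + \<bar>z - w\<bar>\<^sup>2 / (2 * Im z * Im w)\<close>, which leaves the squares of the four entries.\<close>

lemma hdist_disc_geodesic:
  assumes \<rho>: "cmod \<rho> = 1" and b: "0 < b" and p: "0 < 1 + u * v" and p': "0 < 1 + u' * v'"
  shows "hdist (disc_geodesic \<rho> a b u v t) (disc_geodesic \<rho> a b u' v' t') =
    arcosh (((u - u')\<^sup>2 + (v - v')\<^sup>2 * (exp (- t))\<^sup>2 * (exp (- t'))\<^sup>2
      + (exp (- t))\<^sup>2 * (1 + u' * v)\<^sup>2 + (exp (- t'))\<^sup>2 * (1 + u * v')\<^sup>2)
      / (2 * exp (- t) * exp (- t') * (1 + u * v) * (1 + u' * v')))"
proof -
  define x y where "x = exp (- t)" and "y = exp (- t')"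
  have xy: "0 < x" "0 < y" by (auto simp: x_def y_def)
  define z w where "z = uhp_geodesic u v t" and "w = uhp_geodesic u' v' t'"
  define X Y where "X = 1 + (v * x)\<^sup>2" and "Y = 1 + (v' * y)\<^sup>2"
  have XY: "0 < X" "0 < Y" by (auto simp: X_def Y_def intro: add_pos_nonneg)
  have im: "Im z = x * (1 + u * v) / X" "Im w = y * (1 + u' * v') / Y"
    by (auto simp: z_def w_def Im_uhp_geodesic x_def y_def X_def Y_def)
  have "z - w = (Complex u x * Complex 1 (- v' * y) - Complex u' y * Complex 1 (- v * x))
      / (Complex 1 (- v * x) * Complex 1 (- v' * y))"
    unfolding z_def w_def uhp_geodesic_def x_def y_def using uhp_geodesic_denom_nonzero by (simp add: diff_frac_eq)
  then have "(cmod (z - w))\<^sup>2 = ((u - u' + (v' - v) * x * y)\<^sup>2 + (x * (1 + u' * v) - y * (1 + u * v'))\<^sup>2) / (X * Y)"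
    by (simp add: norm_divide norm_mult power_divide power_mult_distrib cmod_power2 X_def Y_def)
      (auto simp: algebra_simps)
  then have "1 + (cmod (z - w))\<^sup>2 / (2 * Im z * Im w) =
      1 + ((u - u' + (v' - v) * x * y)\<^sup>2 + (x * (1 + u' * v) - y * (1 + u * v'))\<^sup>2)
        / (2 * x * y * (1 + u * v) * (1 + u' * v'))"
    unfolding im using XY by (simp add: field_simps)
  also have "\<dots> = (2 * x * y * (1 + u * v) * (1 + u' * v')
      + ((u - u' + (v' - v) * x * y)\<^sup>2 + (x * (1 + u' * v) - y * (1 + u * v'))\<^sup>2))
        / (2 * x * y * (1 + u * v) * (1 + u' * v'))"
    using xy p p' by (subst add_divide_distrib) auto
  also have "2 * x * y * (1 + u * v) * (1 + u' * v')
      + ((u - u' + (v' - v) * x * y)\<^sup>2 + (x * (1 + u' * v) - y * (1 + u * v'))\<^sup>2)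
      = (u - u')\<^sup>2 + (v - v')\<^sup>2 * x\<^sup>2 * y\<^sup>2 + x\<^sup>2 * (1 + u' * v)\<^sup>2 + y\<^sup>2 * (1 + u * v')\<^sup>2"
    by algebra
  finally have *: "1 + (cmod (z - w))\<^sup>2 / (2 * Im z * Im w) = \<dots> / (2 * x * y * (1 + u * v) * (1 + u' * v'))" .
  have "hdist (disc_geodesic \<rho> a b u v t) (disc_geodesic \<rho> a b u' v' t')
      = arcosh (1 + (cmod (of_real a + of_real b * z - (of_real a + of_real b * w)))\<^sup>2
          / (2 * Im (of_real a + of_real b * z) * Im (of_real a + of_real b * w)))"
    unfolding disc_geodesic_def z_def w_def using \<rho> b Im_uhp_geodesic_pos[OF p] Im_uhp_geodesic_pos[OF p']
    by (intro hdist_cayley) auto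
  also have "of_real a + of_real b * z - (of_real a + of_real b * w) = of_real b * (z - w)"
    by (simp add: algebra_simps)
  also have "(cmod (of_real b * (z - w)))\<^sup>2 / (2 * Im (of_real a + of_real b * z) * Im (of_real a + of_real b * w))
      = (cmod (z - w))\<^sup>2 / (2 * Im z * Im w)"
    using b by (simp add: norm_mult power_mult_distrib power2_eq_square)
  finally show ?thesis unfolding * x_def y_def .
qed

lemma geodesic_on_disc_geodesic:
  assumes "cmod \<rho> = 1" "0 < b" "0 < 1 + u * v"
  shows "geodesic_on I (disc_geodesic \<rho> a b u v)"
  unfolding geodesic_on_def
proof (intro conjI ballI)
  show "disc_geodesic \<rho> a b u v ` I \<subseteq> hplane" using disc_geodesic_in_hplane assms by auto
  fix s t
  have "hdist (disc_geodesic \<rho> a b u v s) (disc_geodesic \<rho> a b u v t) = arcosh (((exp (- s))\<^sup>2 + (exp (- t))\<^sup>2) / (2 * exp (- s) * exp (- t)))"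
    unfolding hdist_disc_geodesic[OF assms(1,2,3,3)] using assms(3)
    by (simp add: distrib_right[symmetric] power2_eq_square[of "1 + u * v"] mult.assoc[symmetric] nonzero_mult_divide_mult_cancel_right)
  also have "((exp (- s))\<^sup>2 + (exp (- t))\<^sup>2) / (2 * exp (- s) * exp (- t)) = cosh (\<bar>s - t\<bar>)"
    by (simp add: cosh_def exp_minus exp_diff abs_if power2_eq_square field_simps)
  finally show "hdist (disc_geodesic \<rho> a b u v s) (disc_geodesic \<rho> a b u v t) = \<bar>s - t\<bar>"
    by (simp only: arcosh_cosh_real abs_ge_zero)
qed

lemma geodesic_segment_disc_geodesic:
  assumes "cmod \<rho> = 1" "0 < b" "0 < 1 + u * v" "x \<le> y"
  shows "geodesic_segment (y - x) (disc_geodesic \<rho> a b u v ` {x..y})"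
  unfolding geodesic_segment_def
proof (intro exI conjI)
  show "geodesic_on {0..y - x} (\<lambda>t. disc_geodesic \<rho> a b u v (x + t))"
    using geodesic_on_disc_geodesic[OF assms(1-3), of UNIV] by (auto simp: geodesic_on_def)
  have "(\<lambda>t. x + t) ` {0..y - x} = {x..y}" by simp
  then show "disc_geodesic \<rho> a b u v ` {x..y} = (\<lambda>t. disc_geodesic \<rho> a b u v (x + t)) ` {0..y - x}"
    by (metis image_image)
qed

lemma continuous_on_disc_geodesic:
  assumes "0 < b" "\<And>u v. (u, v) \<in> P \<Longrightarrow> 0 < 1 + u * v"
  shows "continuous_on (P \<times> J) (\<lambda>(p, t). disc_geodesic \<rho> a b (fst p) (snd p) t)"
proof -
  have "of_real a + of_real b * uhp_geodesic u v t + \<i> \<noteq> 0" if "(u, v) \<in> P" for u v t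
    using assms that Im_uhp_geodesic_pos[of u v t] by (intro uhp_plus_i_nonzero) auto
  then show ?thesis
    unfolding disc_geodesic_def cayley_def uhp_geodesic_def case_prod_unfold
    by (intro continuous_intros) (auto simp: uhp_geodesic_denom_nonzero)
qed

text \<open>For \<open>v = 0\<close> the geodesics in the upper half-plane are vertical lines, and the Cayley map sends
\<open>\<infinity>\<close> to \<open>1\<close>.\<close>

lemma disc_geodesic_tendsto_ideal_point: "(disc_geodesic \<rho> a 1 u 0 \<longlongrightarrow> \<rho>) at_bot"
proof -
  have g: "uhp_geodesic u 0 t = of_real u + \<i> * of_real (exp (- t))" for t
    by (simp add: uhp_geodesic_def complex_eq_iff Re_divide Im_divide)
  have c: "cayley z = 1 - 2 * \<i> / (z + \<i>)" if "z + \<i> \<noteq> 0" for z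
    using that by (simp add: cayley_def field_simps)
  have "filterlim (\<lambda>t::real. 1 + exp (- t)) at_top at_bot"
    by (intro filterlim_tendsto_add_at_top[OF tendsto_const] filterlim_compose[OF exp_at_top] filterlim_uminus_at_top_at_bot)
  then have "filterlim (\<lambda>t. Im (of_real a + of_real 1 * uhp_geodesic u 0 t + \<i>)) at_top at_bot"
    by (simp add: g add.commute)
  then have "filterlim (\<lambda>t. norm (of_real a + of_real 1 * uhp_geodesic u 0 t + \<i>)) at_top at_bot"
    by (rule filterlim_at_top_mono) (auto intro!: always_eventually order_trans[OF _ abs_Im_le_cmod])
  then have "filterlim (\<lambda>t. of_real a + of_real 1 * uhp_geodesic u 0 t + \<i>) at_infinity at_bot"
    by (rule filterlim_norm_at_top_imp_at_infinity)
  then have "((\<lambda>t. \<rho> * (1 - 2 * \<i> / (of_real a + of_real 1 * uhp_geodesic u 0 t + \<i>))) \<longlongrightarrow> \<rho> * (1 - 0)) at_bot"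
    by (intro tendsto_intros tendsto_divide_0[OF tendsto_const])
  moreover have "disc_geodesic \<rho> a 1 u 0 = (\<lambda>t. \<rho> * (1 - 2 * \<i> / (of_real a + of_real 1 * uhp_geodesic u 0 t + \<i>)))"
    unfolding disc_geodesic_def using Im_uhp_geodesic_pos[of u 0] by (subst c) (auto simp: uhp_plus_i_nonzero)
  ultimately show ?thesis by simp
qed

section \<open>Divergence of the geodesics of the family\<close>

lemma le_arcosh: "0 \<le> R \<Longrightarrow> cosh R \<le> (x::real) \<Longrightarrow> R \<le> arcosh x"
  using arcosh_less_iff_real[of x "cosh R"] cosh_real_ge_1[of R] arcosh_cosh_real[of R]
  by linarith

text \<open>In the sum of four squares, two of them at a time are bounded below by the arithmetic-geometric mean
inequality so that the time \<open>t\<close> cancels. Hence the bound is one for the distance from the point at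
time \<open>t'\<close> to the whole of the other geodesic. The factor 9 bounds the determinant.\<close>

lemma hdist_disc_geodesic_far:
  assumes \<rho>: "cmod \<rho> = 1" and b: "0 < b"
    and u: "u \<in> {0..1}" "u' \<in> {0..1}" and v: "v \<in> {0..2}" "v' \<in> {0..2}"
    and R: "0 \<le> R" and far: "9 * cosh R \<le> \<bar>u - u'\<bar> * exp t' \<or> 9 * cosh R \<le> \<bar>v - v'\<bar> * exp (- t')"
  shows "R \<le> hdist (disc_geodesic \<rho> a b u v t) (disc_geodesic \<rho> a b u' v' t')"
proof -
  define x y where "x = exp (- t)" and "y = exp (- t')"
  have xy: "0 < x" "0 < y" by (auto simp: x_def y_def)
  define D E where "D = \<bar>u - u'\<bar>" and "E = \<bar>v - v'\<bar>"
  have nonneg: "0 \<le> u * v" "0 \<le> u' * v'" "0 \<le> u' * v" "0 \<le> u * v'" "0 \<le> D" "0 \<le> E"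
    using u v by (auto simp: D_def E_def)
  have "u * v \<le> 1 * 2" "u' * v' \<le> 1 * 2"
    using u v by (intro mult_mono; simp)+
  then have "(1 + u * v) * (1 + u' * v') \<le> 3 * 3"
    using nonneg by (intro mult_mono) auto
  then have denom: "2 * x * y * (1 + u * v) * (1 + u' * v') \<le> 18 * x * y"
    using mult_left_mono[of "(1 + u * v) * (1 + u' * v')" 9 "2 * x * y"] xy
    by (simp add: mult.assoc)
  define N where "N = D\<^sup>2 + E\<^sup>2 * x\<^sup>2 * y\<^sup>2 + x\<^sup>2 * (1 + u' * v)\<^sup>2 + y\<^sup>2 * (1 + u * v')\<^sup>2"
  have "x\<^sup>2 * 1 \<le> x\<^sup>2 * (1 + u' * v)\<^sup>2" "y\<^sup>2 * 1 \<le> y\<^sup>2 * (1 + u * v')\<^sup>2"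
    using nonneg by (intro mult_left_mono; simp)+
  moreover have "0 \<le> D\<^sup>2 + x\<^sup>2 - 2 * D * x" "0 \<le> E\<^sup>2 * x\<^sup>2 * y\<^sup>2 + y\<^sup>2 - 2 * E * x * y\<^sup>2"
    using zero_le_power2[of "D - x"] mult_nonneg_nonneg[OF zero_le_power2[of y] zero_le_power2[of "E * x - 1"]]
    by (simp_all add: power2_eq_square algebra_simps)
  moreover have "0 \<le> E\<^sup>2 * x\<^sup>2 * y\<^sup>2" "0 \<le> D\<^sup>2" "0 \<le> y\<^sup>2" "0 \<le> x\<^sup>2" by auto
  ultimately have N: "2 * D * x \<le> N" "2 * E * x * y\<^sup>2 \<le> N"
    unfolding N_def by linarith+
  have "cosh R * (18 * x * y) \<le> N"
  proof (cases "9 * cosh R \<le> D * exp t'")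
    case True
    then have "9 * cosh R * y \<le> D"
      by (simp add: y_def exp_minus field_simps)
    from mult_right_mono[OF this, of "2 * x"] xy have "cosh R * (18 * x * y) \<le> 2 * D * x"
      by (simp add: mult_ac)
    then show ?thesis using N(1) by linarith
  next
    case False
    then have "9 * cosh R \<le> E * y"
      using far by (simp add: y_def D_def E_def)
    from mult_right_mono[OF this, of "2 * x * y"] xy have "cosh R * (18 * x * y) \<le> 2 * E * x * y\<^sup>2"
      by (simp add: mult_ac power2_eq_square)
    then show ?thesis using N(2) by linarith
  qed
  moreover have "cosh R * (2 * x * y * (1 + u * v) * (1 + u' * v')) \<le> cosh R * (18 * x * y)"
    using denom by (intro mult_left_mono) auto
  ultimately have "cosh R * (2 * x * y * (1 + u * v) * (1 + u' * v')) \<le> N"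
    by (rule order_trans[rotated])
  then have "cosh R \<le> N / (2 * x * y * (1 + u * v) * (1 + u' * v'))"
    using xy nonneg by (subst pos_le_divide_eq) (auto intro!: mult_pos_pos add_pos_nonneg simp del: times_divide_eq_right)
  then have "R \<le> arcosh (N / (2 * x * y * (1 + u * v) * (1 + u' * v')))"
    by (rule le_arcosh[OF R])
  then show ?thesis
    using hdist_disc_geodesic[OF \<rho> b, of u v u' v' a t t'] nonneg
    by (simp add: N_def D_def E_def x_def y_def)
qed

text \<open>Horocyclic translations move the points of bounded height apart uniformly: the real parts differ by
much while the imaginary parts stay bounded.\<close>

lemma hdist_translates_far:
  assumes \<rho>: "cmod \<rho> = 1" and uv: "0 < 1 + u * v" "0 < 1 + u' * v'" and R: "0 \<le> R"
    and z: "\<bar>Re (uhp_geodesic u v t)\<bar> \<le> 2" "Im (uhp_geodesic u v t) \<le> 2"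
    and w: "\<bar>Re (uhp_geodesic u' v' t')\<bar> \<le> 2" "Im (uhp_geodesic u' v' t') \<le> 2"
    and far: "8 * cosh R + 4 \<le> \<bar>a - a'\<bar>"
  shows "R \<le> hdist (disc_geodesic \<rho> a 1 u v t) (disc_geodesic \<rho> a' 1 u' v' t')"
proof -
  define z w where "z = of_real a + of_real 1 * uhp_geodesic u v t" and "w = of_real a' + of_real 1 * uhp_geodesic u' v' t'"
  have im: "0 < Im z" "Im z \<le> 2" "0 < Im w" "Im w \<le> 2"
    using Im_uhp_geodesic_pos[OF uv(1), of t] Im_uhp_geodesic_pos[OF uv(2), of t'] z w by (auto simp: z_def w_def)
  have "8 * cosh R \<le> \<bar>Re (z - w)\<bar>"
    using far z(1) w(1) by (simp add: z_def w_def)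
  also have "\<dots> \<le> cmod (z - w)" by (rule abs_Re_le_cmod)
  finally have "(8 * cosh R)\<^sup>2 \<le> (cmod (z - w))\<^sup>2"
    using cosh_real_pos[of R] by (intro power_mono) auto
  moreover have "cosh R * (2 * Im z * Im w) \<le> cosh R * 8"
    using mult_mono[OF im(2,4)] im cosh_real_pos[of R] by (intro mult_left_mono) (auto simp: mult_ac)
  moreover have "cosh R * 1 \<le> cosh R * cosh R"
    using cosh_real_ge_1[of R] by (intro mult_left_mono) auto
  then have "cosh R * 8 \<le> (8 * cosh R)\<^sup>2"
    using cosh_real_pos[of R] by (simp add: power2_eq_square)
  ultimately have "cosh R * (2 * Im z * Im w) \<le> (cmod (z - w))\<^sup>2" by linarith
  then have "cosh R \<le> (cmod (z - w))\<^sup>2 / (2 * Im z * Im w)"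
    using im by (subst pos_le_divide_eq) auto
  then have "R \<le> arcosh (1 + (cmod (z - w))\<^sup>2 / (2 * Im z * Im w))"
    by (intro le_arcosh R) auto
  then show ?thesis
    unfolding disc_geodesic_def using hdist_cayley[OF im(1,3) \<rho>] by (simp add: z_def w_def)
qed

lemma uhp_geodesic_bounded_one_parameter:
  assumes "u \<in> {0..1}" "0 \<le> t"
  shows "\<bar>Re (uhp_geodesic u 0 t)\<bar> \<le> 2" "Im (uhp_geodesic u 0 t) \<le> 2"
  using assms exp_le_one_iff[of "-t"] by (auto simp: Re_uhp_geodesic Im_uhp_geodesic simp del: exp_le_one_iff)

lemma uhp_geodesic_bounded_two_parameter:
  assumes "u \<in> {0..1}" "v \<in> {1..2}"
  shows "\<bar>Re (uhp_geodesic u v t)\<bar> \<le> 2" "Im (uhp_geodesic u v t) \<le> 2"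
proof -
  have u: "0 \<le> u" "u \<le> 1" using assms by auto
  define x where "x = exp (- t)"
  have x: "0 < x" by (simp add: x_def)
  have "1 * x\<^sup>2 \<le> v\<^sup>2 * x\<^sup>2"
    using assms by (intro mult_right_mono) auto
  then have vx: "x\<^sup>2 \<le> (v * x)\<^sup>2" by (simp add: power_mult_distrib)
  have denom: "0 < 1 + (v * x)\<^sup>2" by (auto intro: add_pos_nonneg)
  have "v * x\<^sup>2 \<le> 2 * x\<^sup>2" using assms by (intro mult_right_mono) auto
  moreover have "0 \<le> v * x\<^sup>2" "0 \<le> (v * x)\<^sup>2" using assms by auto
  ultimately have "\<bar>u - v * x\<^sup>2\<bar> \<le> 2 * (1 + (v * x)\<^sup>2)"
    using u vx unfolding abs_le_iff by (smt (verit))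
  then show "\<bar>Re (uhp_geodesic u v t)\<bar> \<le> 2"
    using denom by (simp add: Re_uhp_geodesic x_def[symmetric] pos_divide_le_eq)
  have "u * v \<le> 1 * 2" using assms by (intro mult_mono) auto
  then have "x * (1 + u * v) \<le> x * 3" using x by (intro mult_left_mono) auto
  also have "x * 3 \<le> 2 * (1 + x\<^sup>2)" using zero_le_power2[of "x - 1"] x by (simp add: power2_eq_square algebra_simps)
  also have "\<dots> \<le> 2 * (1 + (v * x)\<^sup>2)" using vx by simp
  finally show "Im (uhp_geodesic u v t) \<le> 2"
    using denom by (simp add: Im_uhp_geodesic x_def[symmetric] pos_divide_le_eq)
qed

section \<open>All half-lines through a point\<close>

lemma cosh_hdist:
  assumes "z \<in> hplane" "w \<in> hplane"
  shows "cosh (hdist z w) = 1 + 2 * (cmod (z - w))\<^sup>2 / ((1 - (cmod z)\<^sup>2) * (1 - (cmod w)\<^sup>2))"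
  unfolding hdist_def using assms
  by (intro cosh_arcosh_real) (auto simp: hplane_def abs_square_less_1 intro!: divide_nonneg_pos mult_pos_pos)

text \<open>The left-hand side is the expression that defines \<open>hdist\<close> for two points on the same diameter
at distances \<open>s\<close> and \<open>t\<close> from the origin.\<close>

lemma cosh_diff_via_tanh:
  fixes s t :: real
  shows "1 + 2 * (tanh (s / 2) - tanh (t / 2))\<^sup>2 / ((1 - (tanh (s / 2))\<^sup>2) * (1 - (tanh (t / 2))\<^sup>2)) = cosh (s - t)"
proof -
  have t2: "1 - (tanh x)\<^sup>2 = 1 / (cosh x)\<^sup>2" for x :: real
    using cosh_real_pos[of x] sinh_square_eq[of x] by (simp add: tanh_def power_divide diff_divide_distrib)
  have "tanh (s / 2) - tanh (t / 2) = sinh (s / 2 - t / 2) / (cosh (s / 2) * cosh (t / 2))"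
    unfolding sinh_diff using cosh_real_pos[of "s / 2"] cosh_real_pos[of "t / 2"]
    by (simp add: tanh_def field_simps)
  then have "1 + 2 * (tanh (s / 2) - tanh (t / 2))\<^sup>2 / ((1 - (tanh (s / 2))\<^sup>2) * (1 - (tanh (t / 2))\<^sup>2))
      = 1 + 2 * (sinh (s / 2 - t / 2))\<^sup>2"
    unfolding t2 using cosh_real_pos[of "s / 2"] cosh_real_pos[of "t / 2"] by (simp add: power_divide power_mult_distrib)
  also have "\<dots> = cosh (2 * (s / 2 - t / 2))"
    unfolding cosh_double cosh_square_eq by simp
  finally show ?thesis by (simp add: right_diff_distrib)
qed

definition radial :: "complex \<Rightarrow> real \<Rightarrow> complex" where
  "radial \<theta> t = of_real (tanh (t / 2)) * \<theta>"

lemma radial_geodesic: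
  assumes "cmod \<theta> = 1"
  shows "geodesic_on I (radial \<theta>)"
proof -
  have "hdist (radial \<theta> s) (radial \<theta> t) = \<bar>s - t\<bar>" for s t
  proof -
    have "cmod (radial \<theta> s - radial \<theta> t) = \<bar>tanh (s / 2) - tanh (t / 2)\<bar>"
      unfolding radial_def left_diff_distrib[symmetric] of_real_diff[symmetric] norm_mult using assms by (simp del: of_real_diff)
    then have "hdist (radial \<theta> s) (radial \<theta> t) = arcosh (cosh \<bar>s - t\<bar>)"
      unfolding hdist_def using assms cosh_diff_via_tanh[of s t] by (simp add: radial_def norm_mult)
    then show ?thesis by (simp only: arcosh_cosh_real abs_ge_zero)
  qed
  moreover have "radial \<theta> t \<in> hplane" for t
    using assms tanh_real_lt_1[of "t / 2"] tanh_real_gt_neg1[of "t / 2"] by (simp add: radial_def hplane_def norm_mult)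
  ultimately show ?thesis by (auto simp: geodesic_on_def)
qed

text \<open>The distances to the origin determine \<open>cmod (\<gamma> t)\<close>, and the distance to \<open>\<gamma> 1\<close> is then the one
between two points on the same radius. So equality holds in the Cauchy-Schwarz inequality for
\<open>\<gamma> t\<close> and \<open>\<gamma> 1\<close>.\<close>

lemma ray_from_origin_radial:
  assumes \<gamma>: "geodesic_on {0..} \<gamma>" and 0: "\<gamma> 0 = 0"
  shows "\<exists>\<theta>. cmod \<theta> = 1 \<and> (\<forall>t\<ge>0. \<gamma> t = radial \<theta> t)"
proof -
  have plane: "\<gamma> t \<in> hplane" if "0 \<le> t" for t
    using \<gamma> that by (auto simp: geodesic_on_def)
  have dist: "1 + 2 * (cmod (\<gamma> s - \<gamma> t))\<^sup>2 / ((1 - (cmod (\<gamma> s))\<^sup>2) * (1 - (cmod (\<gamma> t))\<^sup>2)) = cosh (s - t)"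
    if "0 \<le> s" "0 \<le> t" for s t
    using cosh_hdist[OF plane[OF that(1)] plane[OF that(2)]] \<gamma> that by (simp add: geodesic_on_def)
  have lt1: "0 < 1 - (tanh x)\<^sup>2" for x :: real
    using tanh_real_lt_1[of x] tanh_real_gt_neg1[of x] by (simp add: abs_square_less_1 abs_less_iff)
  have norm: "cmod (\<gamma> t) = tanh (t / 2)" if t: "0 \<le> t" for t
  proof -
    have pos: "0 < 1 - (cmod (\<gamma> t))\<^sup>2" using plane[OF t] by (simp add: hplane_def abs_square_less_1)
    have "2 * (cmod (\<gamma> t))\<^sup>2 / (1 - (cmod (\<gamma> t))\<^sup>2) = 2 * (tanh (t / 2))\<^sup>2 / (1 - (tanh (t / 2))\<^sup>2)"
      using dist[OF t order_refl] cosh_diff_via_tanh[of t 0] by (simp add: 0)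
    then have "(cmod (\<gamma> t))\<^sup>2 = (tanh (t / 2))\<^sup>2"
      using pos lt1[of "t / 2"] by (simp add: field_simps)
    then show ?thesis using t by simp
  qed
  define l where "l = tanh (1 / 2 :: real)"
  have l: "0 < l" by (simp add: l_def)
  have l1: "cmod (\<gamma> 1) = l" using norm[of 1] by (simp add: l_def)
  show ?thesis
  proof (intro exI conjI allI impI)
    show "cmod (\<gamma> 1 / of_real l) = 1" using l l1 by (simp add: norm_divide)
    fix t :: real assume t: "0 \<le> t"
    have "(cmod (\<gamma> t - \<gamma> 1))\<^sup>2 = (tanh (t / 2) - l)\<^sup>2"
    proof -
      have "2 * (cmod (\<gamma> t - \<gamma> 1))\<^sup>2 / ((1 - (tanh (t / 2))\<^sup>2) * (1 - l\<^sup>2))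
          = 2 * (tanh (t / 2) - l)\<^sup>2 / ((1 - (tanh (t / 2))\<^sup>2) * (1 - l\<^sup>2))"
        using dist[OF t zero_le_one, unfolded norm[OF t] l1] cosh_diff_via_tanh[of t 1, folded l_def]
        by linarith
      moreover have "(1 - (tanh (t / 2))\<^sup>2) * (1 - l\<^sup>2) \<noteq> 0"
        using lt1[of "t / 2"] lt1[of "1 / 2"] unfolding l_def by (metis less_irrefl mult_eq_0_iff)
      ultimately show ?thesis by (simp only: divide_cancel_right) simp
    qed
    then have "inner (\<gamma> t) (\<gamma> 1) = cmod (\<gamma> t) * cmod (\<gamma> 1)"
      unfolding dot_norm_neg by (simp add: norm[OF t] l1 power2_diff)
    then have "cmod (\<gamma> t) *\<^sub>R \<gamma> 1 = cmod (\<gamma> 1) *\<^sub>R \<gamma> t"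
      by (simp add: norm_cauchy_schwarz_eq)
    then show "\<gamma> t = radial (\<gamma> 1 / of_real l) t"
      using l by (simp add: radial_def norm[OF t] l1 scaleR_conv_of_real field_simps)
  qed
qed

definition cayley_inv :: "complex \<Rightarrow> complex" where
  "cayley_inv w = \<i> * (1 + w) / (1 - w)"

lemma hplane_one_minus_nonzero: "w \<in> hplane \<Longrightarrow> 1 - w \<noteq> 0"
  by (auto simp: hplane_def)

lemma Im_cayley_inv_pos:
  assumes "w \<in> hplane"
  shows "0 < Im (cayley_inv w)"
proof -
  have "Im (cayley_inv w) = (1 - (cmod w)\<^sup>2) / (cmod (1 - w))\<^sup>2"
    unfolding cayley_inv_def Im_divide cmod_power2 by (simp add: power2_eq_square algebra_simps)
  then show ?thesis
    using assms hplane_one_minus_nonzero[OF assms] by (simp add: hplane_def abs_square_less_1)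
qed

lemma cayley_cayley_inv:
  assumes "w \<in> hplane"
  shows "cayley (cayley_inv w) = w"
proof -
  have "cayley_inv w - \<i> = 2 * \<i> * w / (1 - w)" "cayley_inv w + \<i> = 2 * \<i> / (1 - w)"
    using hplane_one_minus_nonzero[OF assms] unfolding cayley_inv_def by (simp_all add: field_simps)
  then show ?thesis
    using hplane_one_minus_nonzero[OF assms] by (simp add: cayley_def)
qed

lemma cayley_inv_cayley:
  assumes "0 < Im z"
  shows "cayley_inv (cayley z) = z"
proof -
  have "1 + cayley z = 2 * z / (z + \<i>)" "1 - cayley z = 2 * \<i> / (z + \<i>)"
    using uhp_plus_i_nonzero[OF assms] unfolding cayley_def by (simp_all add: field_simps)
  then show ?thesis
    using uhp_plus_i_nonzero[OF assms] by (simp add: cayley_inv_def)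
qed

definition disc_affine :: "real \<Rightarrow> real \<Rightarrow> complex \<Rightarrow> complex" where
  "disc_affine a b w = cayley (of_real a + of_real b * cayley_inv w)"

lemma disc_affine_in_hplane:
  "0 < b \<Longrightarrow> w \<in> hplane \<Longrightarrow> disc_affine a b w \<in> hplane"
  using cayley_in_hplane[of "of_real a + of_real b * cayley_inv w" 1] Im_cayley_inv_pos[of w]
  by (simp add: disc_affine_def)

lemma hdist_disc_affine:
  assumes b: "0 < b" and "z \<in> hplane" "w \<in> hplane"
  shows "hdist (disc_affine a b z) (disc_affine a b w) = hdist z w"
proof -
  note pos = Im_cayley_inv_pos[OF assms(2)] Im_cayley_inv_pos[OF assms(3)]
  have "hdist (disc_affine a b z) (disc_affine a b w)
      = arcosh (1 + (cmod (of_real b * (cayley_inv z - cayley_inv w)))\<^sup>2 / (2 * (b * Im (cayley_inv z)) * (b * Im (cayley_inv w))))"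
    using hdist_cayley[of "of_real a + of_real b * cayley_inv z" "of_real a + of_real b * cayley_inv w" 1] b pos
    by (simp add: disc_affine_def right_diff_distrib)
  also have "\<dots> = arcosh (1 + (cmod (cayley_inv z - cayley_inv w))\<^sup>2 / (2 * Im (cayley_inv z) * Im (cayley_inv w)))"
    using b by (simp add: norm_mult power_mult_distrib power2_eq_square mult.assoc)
  also have "\<dots> = hdist z w"
    using hdist_cayley[OF pos, of 1] assms by (simp add: cayley_cayley_inv)
  finally show ?thesis .
qed

lemma disc_affine_inverse:
  assumes "0 < b" "w \<in> hplane"
  shows "disc_affine a b (disc_affine (- a / b) (1 / b) w) = w"
  using assms Im_cayley_inv_pos[of w]
  by (simp add: disc_affine_def cayley_inv_cayley cayley_cayley_inv ring_distribs)

lemma disc_affine_transitive: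
  assumes "x \<in> hplane"
  obtains a b where "0 < b" "disc_affine a b 0 = x"
proof
  show "0 < Im (cayley_inv x)" by (rule Im_cayley_inv_pos[OF assms])
  have "cayley_inv x = of_real (Re (cayley_inv x)) + of_real (Im (cayley_inv x)) * \<i>"
    by (simp add: complex_eq_iff)
  then show "disc_affine (Re (cayley_inv x)) (Im (cayley_inv x)) 0 = x"
    unfolding disc_affine_def using cayley_cayley_inv[OF assms] by (simp add: cayley_inv_def)
qed

lemma continuous_on_disc_affine:
  assumes "0 < b"
  shows "continuous_on hplane (disc_affine a b)"
proof -
  have "of_real a + of_real b * cayley_inv w + \<i> \<noteq> 0" if "w \<in> hplane" for w
    using Im_cayley_inv_pos[OF that] assms by (intro uhp_plus_i_nonzero) auto
  then show ?thesis
    unfolding disc_affine_def cayley_def cayley_inv_def using hplane_one_minus_nonzero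
    by (intro continuous_intros) auto
qed

lemma geodesic_on_isometry:
  assumes "geodesic_on I \<gamma>" "\<And>z. z \<in> hplane \<Longrightarrow> \<phi> z \<in> hplane"
    "\<And>z w. z \<in> hplane \<Longrightarrow> w \<in> hplane \<Longrightarrow> hdist (\<phi> z) (\<phi> w) = hdist z w"
  shows "geodesic_on I (\<lambda>t. \<phi> (\<gamma> t))"
  using assms by (auto simp: geodesic_on_def image_subset_iff)

text \<open>A half-line may contain the point in its interior, but then its tail starts at the point.\<close>

lemma half_line_through_iff:
  "(\<exists>H. half_line H \<and> x \<in> H \<and> H \<subseteq> F) \<longleftrightarrow> (\<exists>\<gamma>. geodesic_on {0..} \<gamma> \<and> \<gamma> 0 = x \<and> (\<forall>t\<ge>0. \<gamma> t \<in> F))"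
proof
  assume "\<exists>H. half_line H \<and> x \<in> H \<and> H \<subseteq> F"
  then obtain \<gamma> s where \<gamma>: "geodesic_on {0..} \<gamma>" "\<gamma> ` {0..} \<subseteq> F" "0 \<le> s" "x = \<gamma> s"
    by (auto simp: half_line_def)
  then have "geodesic_on {0..} (\<lambda>t. \<gamma> (s + t))" by (auto simp: geodesic_on_def)
  then show "\<exists>\<gamma>. geodesic_on {0..} \<gamma> \<and> \<gamma> 0 = x \<and> (\<forall>t\<ge>0. \<gamma> t \<in> F)"
    using \<gamma> by (intro exI[of _ "\<lambda>t. \<gamma> (s + t)"]) auto
next
  assume "\<exists>\<gamma>. geodesic_on {0..} \<gamma> \<and> \<gamma> 0 = x \<and> (\<forall>t\<ge>0. \<gamma> t \<in> F)"
  then obtain \<gamma> where "geodesic_on {0..} \<gamma>" "\<gamma> 0 = x" "\<forall>t\<ge>0. \<gamma> t \<in> F" by auto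
  then show "\<exists>H. half_line H \<and> x \<in> H \<and> H \<subseteq> F"
    unfolding half_line_def by (intro exI[of _ "\<gamma> ` {0..}"]) auto
qed

text \<open>The half-lines from a point thus form a family with a compact parameter set, the circle of
directions; this is what makes their existence in a random closed set a measurable event.\<close>

lemma half_line_through_radial_iff:
  assumes b: "0 < b"
  shows "(\<exists>H. half_line H \<and> disc_affine a b 0 \<in> H \<and> H \<subseteq> F) \<longleftrightarrow>
    (\<exists>\<theta>\<in>sphere 0 1. \<forall>t\<in>{0..}. disc_affine a b (radial \<theta> t) \<in> F)"
  unfolding half_line_through_iff
proof
  assume "\<exists>\<gamma>. geodesic_on {0..} \<gamma> \<and> \<gamma> 0 = disc_affine a b 0 \<and> (\<forall>t\<ge>0. \<gamma> t \<in> F)"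
  then obtain \<gamma> where \<gamma>: "geodesic_on {0..} \<gamma>" "\<gamma> 0 = disc_affine a b 0" "\<forall>t\<ge>0. \<gamma> t \<in> F" by auto
  let ?\<psi> = "disc_affine (- a / b) (1 / b)"
  have 0: "?\<psi> (disc_affine a b 0) = 0"
    using disc_affine_inverse[of "1 / b" 0 "- a / b"] b by (simp add: hplane_def)
  have "geodesic_on {0..} (\<lambda>t. ?\<psi> (\<gamma> t))"
    using b by (intro geodesic_on_isometry[OF \<gamma>(1)] disc_affine_in_hplane hdist_disc_affine) auto
  then obtain \<theta> where \<theta>: "cmod \<theta> = 1" "\<forall>t\<ge>0. ?\<psi> (\<gamma> t) = radial \<theta> t"
    using ray_from_origin_radial 0 \<gamma>(2) by (metis (no_types, lifting))
  have "disc_affine a b (radial \<theta> t) = \<gamma> t" if "0 \<le> t" for t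
    using disc_affine_inverse[OF b, of "\<gamma> t" a] \<theta>(2) \<gamma>(1) that by (auto simp: geodesic_on_def)
  then show "\<exists>\<theta>\<in>sphere 0 1. \<forall>t\<in>{0..}. disc_affine a b (radial \<theta> t) \<in> F"
    using \<theta>(1) \<gamma>(3) by (intro bexI[of _ \<theta>]) auto
next
  assume "\<exists>\<theta>\<in>sphere 0 1. \<forall>t\<in>{0..}. disc_affine a b (radial \<theta> t) \<in> F"
  then obtain \<theta> where \<theta>: "cmod \<theta> = 1" "\<forall>t\<ge>0. disc_affine a b (radial \<theta> t) \<in> F" by auto
  have "geodesic_on {0..} (\<lambda>t. disc_affine a b (radial \<theta> t))"
    using b by (intro geodesic_on_isometry[OF radial_geodesic] disc_affine_in_hplane hdist_disc_affine \<theta>(1)) auto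
  then show "\<exists>\<gamma>. geodesic_on {0..} \<gamma> \<and> \<gamma> 0 = disc_affine a b 0 \<and> (\<forall>t\<ge>0. \<gamma> t \<in> F)"
    using \<theta>(2) by (intro exI[of _ "\<lambda>t. disc_affine a b (radial \<theta> t)"]) (auto simp: radial_def)
qed

section \<open>Measurability of the existence of a contained curve\<close>

lemma space_closed_sets: "space (closed_sets A) = {F. closedin (top_of_set A) F}"
  unfolding closed_sets_def by (rule space_measure_of) auto

lemma hitting_event_measurable:
  assumes "compact K" "K \<subseteq> A"
  shows "{F \<in> space (closed_sets A). F \<inter> K \<noteq> {}} \<in> sets (closed_sets A)"
proof -
  have "{{F. closedin (top_of_set A) F \<and> F \<inter> K \<noteq> {}} | K. compact K \<and> K \<subseteq> A}
      \<subseteq> Pow {F. closedin (top_of_set A) F}" by auto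
  then show ?thesis
    unfolding space_closed_sets using assms
    by (auto simp: closed_sets_def sets_measure_of intro!: sigma_sets.Basic)
qed

text \<open>A closed set contains \<open>S\<close> if it contains the points of a countable dense subset of \<open>S\<close>.\<close>

lemma contains_set_measurable:
  assumes "S \<subseteq> A"
  shows "{F \<in> space (closed_sets A). S \<subseteq> F} \<in> sets (closed_sets A)"
proof -
  obtain T where T: "countable T" "T \<subseteq> S" "S \<subseteq> closure T" using separable[of S] .
  have "S \<subseteq> F \<longleftrightarrow> (\<forall>t\<in>T. F \<inter> {t} \<noteq> {})" if F: "F \<in> space (closed_sets A)" for F
  proof
    assume T': "\<forall>t\<in>T. F \<inter> {t} \<noteq> {}"
    obtain C where C: "closed C" "F = A \<inter> C"
      using F by (auto simp: space_closed_sets closedin_closed)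
    have "closure T \<subseteq> C" using T' C by (intro closure_minimal) auto
    then show "S \<subseteq> F" using C T assms by auto
  qed (use T in auto)
  then have "{F \<in> space (closed_sets A). S \<subseteq> F} = {F \<in> space (closed_sets A). \<forall>t\<in>T. F \<inter> {t} \<noteq> {}}"
    by blast
  also have "\<dots> \<in> sets (closed_sets A)"
    using T assms by (intro sets.sets_Collect_countable_All' hitting_event_measurable) auto
  finally show ?thesis .
qed

text \<open>Limits of parameters of almost contained curves are parameters of contained curves. The hypothesis
only asks, for times in a dense set, that some curve with a nearby parameter meets the closed set at
a nearby time. This covers two uses: the discretisation that shows measurability, and the passage
from long segments to infinite curves.\<close>

lemma limit_curve_in_closed_set:
  fixes \<Gamma> :: "'p::metric_space \<Rightarrow> real \<Rightarrow> complex"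
  assumes P: "compact P" and cont: "continuous_on (P \<times> J) (\<lambda>(p, t). \<Gamma> p t)"
    and A: "\<And>p t. p \<in> P \<Longrightarrow> t \<in> J \<Longrightarrow> \<Gamma> p t \<in> A" and F: "closedin (top_of_set A) F"
    and T: "T \<subseteq> J" "J \<subseteq> closure T"
    and p: "\<And>n. p n \<in> P"
    and near: "\<And>t. t \<in> T \<Longrightarrow> \<forall>\<^sub>F n in sequentially. \<exists>p'\<in>P. \<exists>t'\<in>J.
      dist p' (p n) \<le> 1 / Suc n \<and> dist t' t \<le> 1 / Suc n \<and> \<Gamma> p' t' \<in> F"
  shows "\<exists>p\<in>P. \<forall>t\<in>J. \<Gamma> p t \<in> F"
proof -
  obtain l k where l: "l \<in> P" and k: "strict_mono k" "(p \<circ> k) \<longlonglongrightarrow> l"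
    using P p unfolding compact_def by metis
  obtain C where C: "closed C" "F = A \<inter> C"
    using F by (auto simp: closedin_closed)
  have k_lim: "filterlim k sequentially sequentially"
    using k(1) by (rule filterlim_subseq)
  have zero: "(\<lambda>n. 1 / real (Suc (k n))) \<longlonglongrightarrow> 0"
    using filterlim_compose[OF LIMSEQ_inverse_real_of_nat k_lim] by (simp add: inverse_eq_divide)
  have inT: "\<Gamma> l t \<in> F" if t: "t \<in> T" for t
  proof -
    define Q where "Q n x \<longleftrightarrow> fst x \<in> P \<and> snd x \<in> J \<and> dist (fst x) (p n) \<le> 1 / Suc n \<and>
      dist (snd x) t \<le> 1 / Suc n \<and> \<Gamma> (fst x) (snd x) \<in> F" for n and x :: "'p \<times> real"
    define q where "q n = (SOME x. Q (k n) x)" for n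
    have "\<forall>\<^sub>F n in sequentially. \<exists>x. Q n x"
      using near[OF t] by eventually_elim (auto simp: Q_def)
    then have "\<forall>\<^sub>F n in sequentially. \<exists>x. Q (k n) x"
      using k_lim by (rule eventually_compose_filterlim)
    then have ev: "\<forall>\<^sub>F n in sequentially. Q (k n) (q n)"
      by eventually_elim (auto simp: q_def intro: someI_ex)
    have "(\<lambda>n. dist (fst (q n)) (p (k n))) \<longlonglongrightarrow> 0"
      by (rule tendsto_sandwich[OF _ _ tendsto_const zero]) (use ev in \<open>auto simp: Q_def elim: eventually_mono\<close>)
    moreover have "(\<lambda>n. dist (p (k n)) l) \<longlonglongrightarrow> 0"
      using tendsto_dist_iff[THEN iffD1, OF k(2)] by (simp add: o_def)
    ultimately have "(\<lambda>n. dist (fst (q n)) (p (k n)) + dist (p (k n)) l) \<longlonglongrightarrow> 0"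
      using tendsto_add by fastforce
    then have "(\<lambda>n. dist (fst (q n)) l) \<longlonglongrightarrow> 0"
      by (rule tendsto_sandwich[OF _ _ tendsto_const, rotated 2]) (auto intro!: always_eventually dist_triangle)
    then have 1: "(\<lambda>n. fst (q n)) \<longlonglongrightarrow> l"
      by (rule tendsto_dist_iff[THEN iffD2])
    have "(\<lambda>n. dist (snd (q n)) t) \<longlonglongrightarrow> 0"
      by (rule tendsto_sandwich[OF _ _ tendsto_const zero]) (use ev in \<open>auto simp: Q_def elim: eventually_mono\<close>)
    then have "(\<lambda>n. snd (q n)) \<longlonglongrightarrow> t"
      by (rule tendsto_dist_iff[THEN iffD2])
    with 1 have lim: "q \<longlonglongrightarrow> (l, t)"
      using tendsto_Pair by fastforce
    have "(\<lambda>n. case q n of (p, t) \<Rightarrow> \<Gamma> p t) \<longlonglongrightarrow> (case (l, t) of (p, t) \<Rightarrow> \<Gamma> p t)"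
      by (rule continuous_on_tendsto_compose[OF cont lim])
        (use l t T ev in \<open>auto simp: Q_def mem_Times_iff elim: eventually_mono\<close>)
    then have "(\<lambda>n. case q n of (p, t) \<Rightarrow> \<Gamma> p t) \<longlonglongrightarrow> \<Gamma> l t"
      by simp
    then have "\<Gamma> l t \<in> C"
      by (rule Lim_in_closed_set[OF C(1), rotated 2])
        (use ev C in \<open>auto simp: Q_def split: prod.splits elim!: eventually_mono\<close>)
    then show ?thesis using A l t T C by auto
  qed
  have "continuous_on J (\<Gamma> l)"
    by (rule continuous_on_compose2[OF cont, of J "\<lambda>t. (l, t)", simplified])
      (use l in \<open>auto intro!: continuous_intros\<close>)
  then have "closedin (top_of_set J) {t \<in> J. \<Gamma> l t \<in> F}"
    using A l F by (intro continuous_closedin_preimage_gen[where T = A, unfolded vimage_def Int_def, simplified]) auto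
  then obtain D where D: "closed D" "{t \<in> J. \<Gamma> l t \<in> F} = J \<inter> D"
    by (auto simp: closedin_closed)
  have "closure T \<subseteq> D"
    using inT D T by (intro closure_minimal) auto
  then show ?thesis using T D l by blast
qed

text \<open>The generators of the sigma-algebra are hitting events of compact sets. The compact sets used here
are the images of small neighbourhoods in the space of parameters and times, because these stay inside
\<open>A\<close> for every \<open>A\<close> that contains the family. This gives measurability with respect to the trace of
the closed set on \<open>A\<close>, as independence of such traces requires.\<close>

lemma contains_curve_measurable:
  fixes \<Gamma> :: "'p::{metric_space, second_countable_topology} \<Rightarrow> real \<Rightarrow> complex"
  assumes P: "compact P" and J: "closed J"
    and cont: "continuous_on (P \<times> J) (\<lambda>(p, t). \<Gamma> p t)"
    and A: "\<And>p t. p \<in> P \<Longrightarrow> t \<in> J \<Longrightarrow> \<Gamma> p t \<in> A"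
  shows "{F \<in> space (closed_sets A). \<exists>p\<in>P. \<forall>t\<in>J. \<Gamma> p t \<in> F} \<in> sets (closed_sets A)"
proof -
  obtain D where D: "countable D" "D \<subseteq> P" "P \<subseteq> closure D" using separable[of P] .
  obtain T where T: "countable T" "T \<subseteq> J" "J \<subseteq> closure T" using separable[of J] .
  define K where "K n p t = (\<lambda>(p, t). \<Gamma> p t) ` ((P \<inter> cball p (1 / Suc n)) \<times> (J \<inter> cball t (1 / Suc n)))"
    for n p t
  have K: "compact (K n p t)" "K n p t \<subseteq> A" for n p t
    unfolding K_def using A P J
    by (auto intro!: compact_continuous_image continuous_on_subset[OF cont]
        compact_Times[OF compact_Int_closed[OF P closed_cball] closed_Int_compact[OF J compact_cball]])
  have "(\<exists>p\<in>P. \<forall>t\<in>J. \<Gamma> p t \<in> F) \<longleftrightarrow> (\<forall>n. \<exists>p\<in>D. \<forall>t\<in>T. F \<inter> K n p t \<noteq> {})" (is "?L \<longleftrightarrow> ?R")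
    if F: "F \<in> space (closed_sets A)" for F
  proof
    assume ?L
    then obtain p where p: "p \<in> P" "\<And>t. t \<in> J \<Longrightarrow> \<Gamma> p t \<in> F" by auto
    show ?R
    proof
      fix n
      obtain p' where p': "p' \<in> D" "dist p' p < 1 / Suc n"
        using subsetD[OF D(3) p(1), unfolded closure_approachable, rule_format, of "1 / Suc n"] by auto
      have "\<Gamma> p t \<in> F \<inter> K n p' t" if "t \<in> T" for t
        unfolding K_def using p p' that T(2)
        by (intro IntI image_eqI[of _ _ "(p, t)"]) auto
      then show "\<exists>p\<in>D. \<forall>t\<in>T. F \<inter> K n p t \<noteq> {}" using p'(1) by blast
    qed
  next
    assume ?R
    then obtain p where p: "\<And>n. p n \<in> D" "\<And>n t. t \<in> T \<Longrightarrow> F \<inter> K n (p n) t \<noteq> {}" by metis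
    show ?L
    proof (rule limit_curve_in_closed_set[OF P cont A _ T(2,3), of F p])
      show "closedin (top_of_set A) F" using F by (simp add: space_closed_sets)
      show "p n \<in> P" for n using p D by auto
      fix t assume t: "t \<in> T"
      have "\<exists>p'\<in>P. \<exists>t'\<in>J. dist p' (p n) \<le> 1 / Suc n \<and> dist t' t \<le> 1 / Suc n \<and> \<Gamma> p' t' \<in> F" for n
        using p(2)[OF t, of n] by (force simp: K_def dist_commute)
      then show "\<forall>\<^sub>F n in sequentially. \<exists>p'\<in>P. \<exists>t'\<in>J.
          dist p' (p n) \<le> 1 / Suc n \<and> dist t' t \<le> 1 / Suc n \<and> \<Gamma> p' t' \<in> F"
        by (intro always_eventually) auto
    qed
  qed
  then have "{F \<in> space (closed_sets A). \<exists>p\<in>P. \<forall>t\<in>J. \<Gamma> p t \<in> F} =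
      {F \<in> space (closed_sets A). \<forall>n. \<exists>p\<in>D. \<forall>t\<in>T. F \<inter> K n p t \<noteq> {}}" by blast
  also have "\<dots> \<in> sets (closed_sets A)"
    using D(1) T(1) hitting_event_measurable[OF K]
    by (intro sets.sets_Collect_countable_All sets.sets_Collect_countable_Ex'
        sets.sets_Collect_countable_All') auto
  finally show ?thesis .
qed

lemma curve_exhaustion:
  fixes \<Gamma> :: "'p::metric_space \<Rightarrow> real \<Rightarrow> complex"
  assumes P: "compact P" and cont: "continuous_on (P \<times> J) (\<lambda>(p, t). \<Gamma> p t)"
    and A: "\<And>p t. p \<in> P \<Longrightarrow> t \<in> J \<Longrightarrow> \<Gamma> p t \<in> A" and F: "closedin (top_of_set A) F"
    and ex: "\<And>n::nat. \<exists>p\<in>P. \<forall>t\<in>J \<inter> {- real n..real n}. \<Gamma> p t \<in> F"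
  shows "\<exists>p\<in>P. \<forall>t\<in>J. \<Gamma> p t \<in> F"
proof -
  obtain p where p: "\<And>n. p n \<in> P" "\<And>n t. t \<in> J \<inter> {- real n..real n} \<Longrightarrow> \<Gamma> (p n) t \<in> F"
    using ex by metis
  show ?thesis
  proof (rule limit_curve_in_closed_set[OF P cont A F order_refl closure_subset p(1)])
    fix t assume t: "t \<in> J"
    have "\<forall>\<^sub>F n in sequentially. \<bar>t\<bar> \<le> real n"
      by (rule eventually_sequentiallyI[of "nat \<lceil>\<bar>t\<bar>\<rceil>"]) linarith
    then show "\<forall>\<^sub>F n in sequentially. \<exists>p'\<in>P. \<exists>t'\<in>J.
        dist p' (p n) \<le> 1 / Suc n \<and> dist t' t \<le> 1 / Suc n \<and> \<Gamma> p' t' \<in> F"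
    proof eventually_elim
      case (elim n)
      then show ?case using p t by (intro bexI[of _ "p n"] bexI[of _ t]) (auto simp: abs_le_iff)
    qed
  qed
qed

section \<open>Second moments and the interaction kernel\<close>

text \<open>This is the Cauchy-Schwarz inequality for the number \<open>X\<close> of events that occur and the indicator of
\<open>X > 0\<close>, obtained from the discriminant of the quadratic \<open>l \<mapsto> E (X - l 1\<^bsub>X > 0\<^esub>)\<^sup>2\<close>.\<close>

lemma (in prob_space) second_moment_method:
  assumes I: "finite I" and E: "\<And>i. i \<in> I \<Longrightarrow> E i \<in> events"
  shows "(\<Sum>i\<in>I. prob (E i))\<^sup>2 \<le> prob (\<Union>i\<in>I. E i) * (\<Sum>i\<in>I. \<Sum>j\<in>I. prob (E i \<inter> E j))"
proof -
  define U where "U = (\<Union>i\<in>I. E i)"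
  define s m where "s = (\<Sum>i\<in>I. prob (E i))" and "m = (\<Sum>i\<in>I. \<Sum>j\<in>I. prob (E i \<inter> E j))"
  have U: "U \<in> events" unfolding U_def using I E by auto
  have quad: "0 \<le> m - 2 * l * s + l\<^sup>2 * prob U" for l :: real
  proof -
    have int: "integrable M (indicator A :: _ \<Rightarrow> real)" if "A \<in> events" for A
      using that by (intro integrable_real_indicator) (auto simp: emeasure_eq_measure)
    have "0 \<le> expectation (\<lambda>x. ((\<Sum>i\<in>I. indicator (E i) x) - l * indicator U x)\<^sup>2)"
      by (intro integral_nonneg_AE) auto
    also have "\<dots> = expectation (\<lambda>x. (\<Sum>i\<in>I. \<Sum>j\<in>I. indicator (E i \<inter> E j) x)
        - 2 * l * (\<Sum>i\<in>I. indicator (E i) x) + l\<^sup>2 * indicator U x)"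
    proof (rule Bochner_Integration.integral_cong[OF refl])
      fix x
      have "(\<Sum>i\<in>I. indicator (E i) x) * indicator U x = (\<Sum>i\<in>I. indicator (E i) x :: real)"
        unfolding sum_distrib_right by (rule sum.cong) (auto simp: U_def indicator_def)
      moreover have "(\<Sum>i\<in>I. indicator (E i) x)\<^sup>2 = (\<Sum>i\<in>I. \<Sum>j\<in>I. indicator (E i \<inter> E j) x :: real)"
        unfolding power2_eq_square sum_product by (simp add: indicator_inter_arith)
      moreover have "(indicator U x)\<^sup>2 = (indicator U x :: real)" by (simp add: indicator_def)
      ultimately show "((\<Sum>i\<in>I. indicator (E i) x) - l * indicator U x)\<^sup>2 =
          (\<Sum>i\<in>I. \<Sum>j\<in>I. indicator (E i \<inter> E j) x)
          - 2 * l * (\<Sum>i\<in>I. indicator (E i) x) + l\<^sup>2 * indicator U x"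
        by (simp add: power2_diff power_mult_distrib mult.assoc mult.left_commute[of _ l])
    qed
    also have "\<dots> = m - 2 * l * s + l\<^sup>2 * prob U"
      using E U by (simp add: int m_def s_def sets.Int_space_eq2 Bochner_Integration.integral_sum)
    finally show ?thesis .
  qed
  have "s\<^sup>2 \<le> prob U * m"
  proof (cases "prob U = 0")
    case True
    have "prob (E i) = 0" if "i \<in> I" for i
      using finite_measure_mono[of "E i" U] that U True by (auto simp: U_def measure_le_0_iff)
    then show ?thesis using True by (simp add: s_def)
  next
    case False
    then have "0 < prob U" by (simp add: zero_less_measure_iff)
    with quad[of "s / prob U"] show ?thesis by (simp add: field_simps power2_eq_square)
  qed
  then show ?thesis by (simp add: U_def s_def m_def)
qed

lemma sum_powr_neg_le:
  assumes "0 \<le> \<alpha>" "\<alpha> < 1"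
  shows "(\<Sum>k=1..n. real k powr - \<alpha>) \<le> real n powr (1 - \<alpha>) / (1 - \<alpha>)"
proof (induction n)
  case (Suc n)
  have step: "(1 - \<alpha>) * real (Suc n) powr - \<alpha> \<le> real (Suc n) powr (1 - \<alpha>) - real n powr (1 - \<alpha>)"
  proof (cases "n = 0")
    case False
    have "\<exists>z. real n < z \<and> z < real (Suc n) \<and> real (Suc n) powr (1 - \<alpha>) - real n powr (1 - \<alpha>)
        = (real (Suc n) - real n) * ((1 - \<alpha>) * z powr (1 - \<alpha> - 1))"
      using False by (intro MVT2) (auto intro!: derivative_eq_intros)
    then obtain z where z: "real n < z" "z < real (Suc n)"
      "real (Suc n) powr (1 - \<alpha>) - real n powr (1 - \<alpha>) = (1 - \<alpha>) * z powr - \<alpha>"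
      by auto
    have "real (Suc n) powr - \<alpha> \<le> z powr - \<alpha>"
      using z assms by (intro powr_mono2') auto
    then show ?thesis unfolding z(3) using assms by (intro mult_left_mono) auto
  qed (use assms in simp)
  then have "real (Suc n) powr - \<alpha> \<le> (real (Suc n) powr (1 - \<alpha>) - real n powr (1 - \<alpha>)) / (1 - \<alpha>)"
    using assms by (simp add: field_simps)
  with Suc show ?case by (simp add: diff_divide_distrib)
qed simp

text \<open>For \<open>\<alpha> < 1\<close> the kernel \<open>x powr -\<alpha>\<close> is integrable at 0, so its average over a grid stays bounded. The
summand 1 in the denominator makes the diagonal term finite.\<close>

lemma sum_kernel_le:
  assumes \<alpha>: "0 \<le> \<alpha>" "\<alpha> < 1" and L: "0 \<le> L" and i: "i < n"
  shows "(\<Sum>j<n. (L * real n / (\<bar>real i - real j\<bar> + 1)) powr \<alpha>) \<le> 2 * L powr \<alpha> / (1 - \<alpha>) * real n"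
proof -
  define f where "f k = real k powr - \<alpha>" for k :: nat
  have "(\<Sum>j<n. f (nat \<bar>int i - int j\<bar> + 1)) = (\<Sum>j\<le>i. f (i - j + 1)) + (\<Sum>j\<in>{i<..<n}. f (j - i + 1))"
  proof -
    have "{..<n} = {..i} \<union> {i<..<n}" "{..i} \<inter> {i<..<n} = {}" using i by auto
    then have "(\<Sum>j<n. f (nat \<bar>int i - int j\<bar> + 1)) =
      (\<Sum>j\<le>i. f (nat \<bar>int i - int j\<bar> + 1)) + (\<Sum>j\<in>{i<..<n}. f (nat \<bar>int i - int j\<bar> + 1))"
      by (simp only: sum.union_disjoint finite_atMost finite_greaterThanLessThan)
    also have "(\<Sum>j\<le>i. f (nat \<bar>int i - int j\<bar> + 1)) = (\<Sum>j\<le>i. f (i - j + 1))"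
      by (intro sum.cong) (auto intro!: arg_cong[where f = f])
    also have "(\<Sum>j\<in>{i<..<n}. f (nat \<bar>int i - int j\<bar> + 1)) = (\<Sum>j\<in>{i<..<n}. f (j - i + 1))"
      by (intro sum.cong) (auto intro!: arg_cong[where f = f])
    finally show ?thesis .
  qed
  also have "(\<Sum>j\<le>i. f (i - j + 1)) = sum f ((\<lambda>j. i - j + 1) ` {..i})"
    by (subst sum.reindex) (auto simp: inj_on_def)
  also have "\<dots> \<le> sum f {1..n}"
    using i by (intro sum_mono2) (auto simp: f_def)
  also have "(\<Sum>j\<in>{i<..<n}. f (j - i + 1)) = sum f ((\<lambda>j. j - i + 1) ` {i<..<n})"
    by (subst sum.reindex) (auto simp: inj_on_def)
  also have "\<dots> \<le> sum f {1..n}"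
    using i by (intro sum_mono2) (auto simp: f_def)
  finally have f: "(\<Sum>j<n. f (nat \<bar>int i - int j\<bar> + 1)) \<le> 2 * (real n powr (1 - \<alpha>) / (1 - \<alpha>))"
    using sum_powr_neg_le[OF \<alpha>, of n] by (simp add: f_def)
  have "(L * real n / (\<bar>real i - real j\<bar> + 1)) powr \<alpha> = (L powr \<alpha> * real n powr \<alpha>) * f (nat \<bar>int i - int j\<bar> + 1)" for j
  proof -
    have "\<bar>real i - real j\<bar> + 1 = real (nat \<bar>int i - int j\<bar> + 1)" by simp
    then show ?thesis unfolding f_def using L by (simp only: powr_divide powr_mult powr_minus_divide) simp
  qed
  then have "(\<Sum>j<n. (L * real n / (\<bar>real i - real j\<bar> + 1)) powr \<alpha>)
      = (L powr \<alpha> * real n powr \<alpha>) * (\<Sum>j<n. f (nat \<bar>int i - int j\<bar> + 1))"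
    by (simp add: sum_distrib_left)
  also have "\<dots> \<le> (L powr \<alpha> * real n powr \<alpha>) * (2 * (real n powr (1 - \<alpha>) / (1 - \<alpha>)))"
    by (intro mult_left_mono f) auto
  also have "\<dots> = 2 * L powr \<alpha> / (1 - \<alpha>) * (real n powr \<alpha> * real n powr (1 - \<alpha>))" by simp
  also have "real n powr \<alpha> * real n powr (1 - \<alpha>) = real n"
    using i by (simp add: powr_add[symmetric])
  finally show ?thesis .
qed

section \<open>Random closed sets with finite range of dependence\<close>

text \<open>The range is taken nonnegative so that \<open>R \<le> hdist a a'\<close> follows from \<open>cosh R \<le> cosh (hdist a a')\<close>.\<close>

locale finite_range_random_closed_set = prob_space M
  for M :: "'w measure" and Z :: "'w \<Rightarrow> complex set" +
  fixes R :: real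
  assumes range_nonneg: "0 \<le> R"
    and random_closed_set: "Z \<in> M \<rightarrow>\<^sub>M closed_sets hplane"
    and independence: "\<And>A A'. A \<subseteq> hplane \<Longrightarrow> A' \<subseteq> hplane \<Longrightarrow>
      (\<And>a a'. a \<in> A \<Longrightarrow> a' \<in> A' \<Longrightarrow> R \<le> hdist a a') \<Longrightarrow>
      indep_var (closed_sets A) (\<lambda>\<omega>. Z \<omega> \<inter> A) (closed_sets A') (\<lambda>\<omega>. Z \<omega> \<inter> A')"
begin

lemma Z_closed: "\<omega> \<in> space M \<Longrightarrow> closedin (top_of_set hplane) (Z \<omega>)"
  using measurable_space[OF random_closed_set] by (simp add: space_closed_sets)

lemma trace_in_space: "\<omega> \<in> space M \<Longrightarrow> A \<subseteq> hplane \<Longrightarrow> Z \<omega> \<inter> A \<in> space (closed_sets A)"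
  using Z_closed[of \<omega>] by (auto simp: space_closed_sets closedin_closed)

lemma prob_conj_far:
  assumes A: "A \<subseteq> hplane" "A' \<subseteq> hplane" "\<And>a a'. a \<in> A \<Longrightarrow> a' \<in> A' \<Longrightarrow> R \<le> hdist a a'"
    and E: "{F \<in> space (closed_sets A). \<Phi> F} \<in> sets (closed_sets A)"
      "{F \<in> space (closed_sets A'). \<Psi> F} \<in> sets (closed_sets A')"
  shows "prob {\<omega> \<in> space M. \<Phi> (Z \<omega> \<inter> A) \<and> \<Psi> (Z \<omega> \<inter> A')} =
    prob {\<omega> \<in> space M. \<Phi> (Z \<omega> \<inter> A)} * prob {\<omega> \<in> space M. \<Psi> (Z \<omega> \<inter> A')}"
proof -
  have "prob ((\<lambda>\<omega>. (Z \<omega> \<inter> A, Z \<omega> \<inter> A')) -`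
        ({F \<in> space (closed_sets A). \<Phi> F} \<times> {F \<in> space (closed_sets A'). \<Psi> F}) \<inter> space M)
      = prob ((\<lambda>\<omega>. Z \<omega> \<inter> A) -` {F \<in> space (closed_sets A). \<Phi> F} \<inter> space M) *
        prob ((\<lambda>\<omega>. Z \<omega> \<inter> A') -` {F \<in> space (closed_sets A'). \<Psi> F} \<inter> space M)"
    by (rule indep_varD[OF independence[OF A] E])
  moreover have "(\<lambda>\<omega>. (Z \<omega> \<inter> A, Z \<omega> \<inter> A')) -`
        ({F \<in> space (closed_sets A). \<Phi> F} \<times> {F \<in> space (closed_sets A'). \<Psi> F}) \<inter> space M
      = {\<omega> \<in> space M. \<Phi> (Z \<omega> \<inter> A) \<and> \<Psi> (Z \<omega> \<inter> A')}"
    using trace_in_space A by auto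
  moreover have "(\<lambda>\<omega>. Z \<omega> \<inter> A) -` {F \<in> space (closed_sets A). \<Phi> F} \<inter> space M = {\<omega> \<in> space M. \<Phi> (Z \<omega> \<inter> A)}"
    using trace_in_space A by auto
  moreover have "(\<lambda>\<omega>. Z \<omega> \<inter> A') -` {F \<in> space (closed_sets A'). \<Psi> F} \<inter> space M = {\<omega> \<in> space M. \<Psi> (Z \<omega> \<inter> A')}"
    using trace_in_space A by auto
  ultimately show ?thesis by simp
qed

lemma event_of_closed_set:
  assumes "{F \<in> space (closed_sets hplane). \<Phi> F} \<in> sets (closed_sets hplane)"
  shows "{\<omega> \<in> space M. \<Phi> (Z \<omega>)} \<in> events"
proof -
  have "Z -` {F \<in> space (closed_sets hplane). \<Phi> F} \<inter> space M \<in> events"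
    using random_closed_set assms by (rule measurable_sets)
  also have "Z -` {F \<in> space (closed_sets hplane). \<Phi> F} \<inter> space M = {\<omega> \<in> space M. \<Phi> (Z \<omega>)}"
    using measurable_space[OF random_closed_set] by auto
  finally show ?thesis .
qed

lemmas contains_set_event = event_of_closed_set[OF contains_set_measurable]
lemmas contains_curve_event = event_of_closed_set[OF contains_curve_measurable]

lemma prob_contains_union_far:
  assumes "S \<subseteq> hplane" "S' \<subseteq> hplane" "\<And>a a'. a \<in> S \<Longrightarrow> a' \<in> S' \<Longrightarrow> R \<le> hdist a a'"
  shows "prob {\<omega> \<in> space M. S \<union> S' \<subseteq> Z \<omega>} = prob {\<omega> \<in> space M. S \<subseteq> Z \<omega>} * prob {\<omega> \<in> space M. S' \<subseteq> Z \<omega>}"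
  using prob_conj_far[OF assms contains_set_measurable[OF order_refl] contains_set_measurable[OF order_refl]]
  by simp

text \<open>A copy is independent of all earlier copies together, so the probability that the first \<open>n\<close> copies
all fail is at most \<open>(1 - \<delta>) ^ n\<close>.\<close>

lemma independent_copies:
  fixes \<Gamma> :: "nat \<Rightarrow> 'p::{metric_space, second_countable_topology} \<Rightarrow> real \<Rightarrow> complex"
  assumes P: "compact P" and J: "closed J"
    and cont: "\<And>k. continuous_on (P \<times> J) (\<lambda>(p, t). \<Gamma> k p t)"
    and \<Gamma>: "\<And>k p t. p \<in> P \<Longrightarrow> t \<in> J \<Longrightarrow> \<Gamma> k p t \<in> hplane"
    and far: "\<And>j k p t p' t'. j < k \<Longrightarrow> p \<in> P \<Longrightarrow> t \<in> J \<Longrightarrow> p' \<in> P \<Longrightarrow> t' \<in> J \<Longrightarrow>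
      R \<le> hdist (\<Gamma> j p t) (\<Gamma> k p' t')"
    and \<delta>: "0 < \<delta>" "\<And>k. \<delta> \<le> prob {\<omega> \<in> space M. \<exists>p\<in>P. \<forall>t\<in>J. \<Gamma> k p t \<in> Z \<omega>}"
  shows "AE \<omega> in M. \<exists>k. \<exists>p\<in>P. \<forall>t\<in>J. \<Gamma> k p t \<in> Z \<omega>"
proof -
  define G where "G k = (\<lambda>(p, t). \<Gamma> k p t) ` (P \<times> J)" for k
  define \<Phi> where "\<Phi> k F \<longleftrightarrow> (\<exists>p\<in>P. \<forall>t\<in>J. \<Gamma> k p t \<in> F)" for k and F :: "complex set"
  have G: "G k \<subseteq> hplane" for k using \<Gamma> by (auto simp: G_def)
  have meas: "{F \<in> space (closed_sets A). \<Phi> k F} \<in> sets (closed_sets A)" if "G k \<subseteq> A" for k A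
    unfolding \<Phi>_def using that by (intro contains_curve_measurable P J cont) (auto simp: G_def)
  have trace: "\<Phi> k (F \<inter> A) \<longleftrightarrow> \<Phi> k F" if "G k \<subseteq> A" for k F A
    using that by (force simp: \<Phi>_def G_def)
  have ev: "{\<omega> \<in> space M. \<Phi> k (Z \<omega>)} \<in> events" for k
    by (intro event_of_closed_set meas G)
  have \<delta>_le: "\<delta> \<le> 1" by (rule order_trans[OF \<delta>(2)[of 0] prob_le_1])
  have bound: "prob {\<omega> \<in> space M. \<forall>k\<in>{..<n}. \<not> \<Phi> k (Z \<omega>)} \<le> (1 - \<delta>) ^ n" for n
  proof (induction n)
    case (Suc n)
    define A where "A = (\<Union>k<n. G k)"
    have G_A: "G k \<subseteq> A" if "k < n" for k using that by (auto simp: A_def)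
    have "prob {\<omega> \<in> space M. \<forall>k\<in>{..<Suc n}. \<not> \<Phi> k (Z \<omega>)} =
        prob {\<omega> \<in> space M. (\<forall>k\<in>{..<n}. \<not> \<Phi> k (Z \<omega> \<inter> A)) \<and> \<not> \<Phi> n (Z \<omega> \<inter> G n)}"
      by (intro arg_cong[where f = prob]) (auto simp: trace[OF G_A] trace less_Suc_eq)
    also have "\<dots> = prob {\<omega> \<in> space M. \<forall>k\<in>{..<n}. \<not> \<Phi> k (Z \<omega> \<inter> A)} * prob {\<omega> \<in> space M. \<not> \<Phi> n (Z \<omega> \<inter> G n)}"
    proof (rule prob_conj_far)
      show "A \<subseteq> hplane" using G by (auto simp: A_def)
      show "R \<le> hdist a a'" if "a \<in> A" "a' \<in> G n" for a a'
        using that far by (auto simp: A_def G_def)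
      show "{F \<in> space (closed_sets A). \<forall>k\<in>{..<n}. \<not> \<Phi> k F} \<in> sets (closed_sets A)"
        by (intro sets.sets_Collect_countable_All' sets.sets_Collect_neg meas) (auto simp: A_def)
      show "{F \<in> space (closed_sets (G n)). \<not> \<Phi> n F} \<in> sets (closed_sets (G n))"
        by (intro sets.sets_Collect_neg meas order_refl)
    qed (rule G)
    also have "{\<omega> \<in> space M. \<forall>k\<in>{..<n}. \<not> \<Phi> k (Z \<omega> \<inter> A)} = {\<omega> \<in> space M. \<forall>k\<in>{..<n}. \<not> \<Phi> k (Z \<omega>)}"
      by (auto simp: trace[OF G_A])
    also have "{\<omega> \<in> space M. \<not> \<Phi> n (Z \<omega> \<inter> G n)} = {\<omega> \<in> space M. \<not> \<Phi> n (Z \<omega>)}"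
      by (simp add: trace)
    also have "prob {\<omega> \<in> space M. \<not> \<Phi> n (Z \<omega>)} = 1 - prob {\<omega> \<in> space M. \<Phi> n (Z \<omega>)}"
      by (rule prob_neg[OF ev])
    also have "prob {\<omega> \<in> space M. \<forall>k\<in>{..<n}. \<not> \<Phi> k (Z \<omega>)} * (1 - prob {\<omega> \<in> space M. \<Phi> n (Z \<omega>)}) \<le> (1 - \<delta>) ^ n * (1 - \<delta>)"
      using Suc \<delta>(2)[of n] \<delta>_le
      by (intro mult_mono) (auto simp: \<Phi>_def intro!: zero_le_power)
    finally show ?case by (simp only: power_Suc2)
  qed simp
  have never: "{\<omega> \<in> space M. \<forall>k. \<not> \<Phi> k (Z \<omega>)} \<in> events"
    by (intro sets.sets_Collect_countable_All sets.sets_Collect_neg ev)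
  have "prob {\<omega> \<in> space M. \<forall>k. \<not> \<Phi> k (Z \<omega>)} \<le> (1 - \<delta>) ^ n" for n
  proof -
    have "{\<omega> \<in> space M. \<forall>k\<in>{..<n}. \<not> \<Phi> k (Z \<omega>)} \<in> events"
      by (intro sets.sets_Collect_countable_All' sets.sets_Collect_neg ev) auto
    then show ?thesis
      by (intro order_trans[OF finite_measure_mono bound[of n]]) auto
  qed
  moreover have "(\<lambda>n. (1 - \<delta>) ^ n) \<longlonglongrightarrow> 0"
    using \<delta>(1) \<delta>_le by (intro LIMSEQ_power_zero) auto
  ultimately have "prob {\<omega> \<in> space M. \<forall>k. \<not> \<Phi> k (Z \<omega>)} \<le> 0"
    by (intro LIMSEQ_le_const) auto
  then have "{\<omega> \<in> space M. \<not> (\<exists>k. \<Phi> k (Z \<omega>))} \<in> null_sets M"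
    using never by (auto simp: null_sets_def emeasure_eq_measure measure_le_0_iff)
  then have "AE \<omega> in M. \<exists>k. \<Phi> k (Z \<omega>)"
    by (rule AE_I') auto
  then show ?thesis by (simp add: \<Phi>_def)
qed

end

section \<open>Survival of geodesics with positive probability\<close>

text \<open>A grid of \<open>n * m\<close> parameters in \<open>P\<close> resolves the segments with times in \<open>[-q, r]\<close> if it is fine on
the scale \<open>exp (- r)\<close> in \<open>u\<close> and on the scale \<open>exp (- q)\<close> in \<open>v\<close>. For one-sided families \<open>q = 0\<close> and
\<open>m = 1\<close>, so that \<open>v\<close> may depend on \<open>u\<close> in any way.\<close>

definition resolving_grids :: "(real \<times> real) set \<Rightarrow> real set \<Rightarrow> bool" where
  "resolving_grids P J \<longleftrightarrow> (\<forall>N :: nat. \<exists>q r n m. \<exists>V :: nat \<Rightarrow> nat \<Rightarrow> real.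
      J \<inter> {- real N..real N} = {-q..r} \<and>
      0 \<le> r \<and> 0 \<le> q \<and> exp r \<le> real n \<and> exp q \<le> real m \<and>
      (\<forall>i<n. \<forall>j<m. (i / n, V i j) \<in> P) \<and>
      (\<forall>i<n. \<forall>j<m. \<forall>i'<n. \<forall>j'<m. \<bar>real j - real j'\<bar> / m \<le> \<bar>V i j - V i' j'\<bar>))"

lemma one_parameter_grid:
  assumes "\<And>u. u \<in> {0..1} \<Longrightarrow> (u, f u) \<in> P"
  shows "resolving_grids P {0..}"
  unfolding resolving_grids_def
proof
  fix N :: nat
  define n where "n = nat \<lceil>exp (real N)\<rceil>"
  have "exp (real N) \<le> real n" by (simp add: n_def real_nat_ceiling_ge)
  moreover have "(i / n, f (i / n)) \<in> P" if "i < n" for i :: nat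
    using that by (intro assms) auto
  ultimately show "\<exists>q r n m. \<exists>V :: nat \<Rightarrow> nat \<Rightarrow> real. {0..} \<inter> {- real N..real N} = {-q..r} \<and>
      0 \<le> r \<and> 0 \<le> q \<and> exp r \<le> real n \<and> exp q \<le> real m \<and>
      (\<forall>i<n. \<forall>j<m. (i / n, V i j) \<in> P) \<and>
      (\<forall>i<n. \<forall>j<m. \<forall>i'<n. \<forall>j'<m. \<bar>real j - real j'\<bar> / m \<le> \<bar>V i j - V i' j'\<bar>)"
    by (intro exI[of _ 0] exI[of _ "real N"] exI[of _ n] exI[of _ "1::nat"]
        exI[of _ "\<lambda>i j. f (real i / real n)"]) auto
qed

lemma two_parameter_grid: "resolving_grids ({0..1} \<times> {1..2}) UNIV"
  unfolding resolving_grids_def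
proof
  fix N :: nat
  define n where "n = nat \<lceil>exp (real N)\<rceil>"
  have n: "exp (real N) \<le> real n" by (simp add: n_def real_nat_ceiling_ge)
  have "(i / n, 1 + j / n) \<in> {0..1} \<times> {1..2 :: real}" if "i < n" "j < n" for i j :: nat
    using that by auto
  moreover have "\<bar>real j - real j'\<bar> / n \<le> \<bar>(1 + j / n) - (1 + j' / n)\<bar>" for j j' :: nat
    by (simp add: diff_divide_distrib[symmetric])
  ultimately show "\<exists>q r n m. \<exists>V :: nat \<Rightarrow> nat \<Rightarrow> real. UNIV \<inter> {- real N..real N} = {-q..r} \<and>
    0 \<le> r \<and> 0 \<le> q \<and> exp r \<le> real n \<and> exp q \<le> real m \<and>
    (\<forall>i<n. \<forall>j<m. (i / n, V i j) \<in> {0..1} \<times> {1..2}) \<and>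
    (\<forall>i<n. \<forall>j<m. \<forall>i'<n. \<forall>j'<m. \<bar>real j - real j'\<bar> / m \<le> \<bar>V i j - V i' j'\<bar>)"
    using n by (intro exI[of _ "real N"] exI[of _ n] exI[of _ "\<lambda>i j. 1 + real j / real n"]) auto
qed

locale finite_range_with_decay = finite_range_random_closed_set +
  fixes \<alpha> c :: real
  assumes exponent: "0 \<le> \<alpha>" "\<alpha> < 1" and c_pos: "0 < c"
    and segment_lower: "\<And>r S. 0 \<le> r \<Longrightarrow> geodesic_segment r S \<Longrightarrow>
      c * exp (- \<alpha> * r) \<le> prob {\<omega> \<in> space M. S \<subseteq> Z \<omega>}"
    and segment_upper: "\<And>r S. 0 \<le> r \<Longrightarrow> geodesic_segment r S \<Longrightarrow>
      prob {\<omega> \<in> space M. S \<subseteq> Z \<omega>} \<le> exp (- \<alpha> * r)"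
begin

text \<open>The first segment is kept whole. Of the second one only the two parts are kept that lie beyond the
separation times \<open>s\<^sub>1\<close> and \<open>s\<^sub>2\<close> in the two directions; they are far from the first segment and from
each other. A part is empty if the separation time exceeds the length, and then the bound
\<open>exp (- \<alpha> * (r - s\<^sub>1))\<close> holds because it is at least 1.\<close>

lemma prob_two_segments_le:
  assumes \<rho>: "cmod \<rho> = 1" and b: "0 < b"
    and u: "u \<in> {0..1}" "u' \<in> {0..1}" and v: "v \<in> {0..2}" "v' \<in> {0..2}"
    and rq: "0 \<le> r" "0 \<le> q" and s: "R \<le> s\<^sub>1" "0 \<le> s\<^sub>2"
    and s\<^sub>1: "r \<le> s\<^sub>1 \<or> 9 * cosh R \<le> \<bar>u - u'\<bar> * exp s\<^sub>1"
    and s\<^sub>2: "q \<le> s\<^sub>2 \<or> 9 * cosh R \<le> \<bar>v - v'\<bar> * exp s\<^sub>2"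
  shows "prob {\<omega> \<in> space M. disc_geodesic \<rho> a b u v ` {-q..r} \<union> disc_geodesic \<rho> a b u' v' ` {-q..r} \<subseteq> Z \<omega>}
    \<le> (exp (- \<alpha> * (r + q)))\<^sup>2 * exp (\<alpha> * s\<^sub>1) * exp (\<alpha> * s\<^sub>2)"
proof -
  have uv: "0 < 1 + u * v" "0 < 1 + u' * v'"
    using u v by (auto intro!: add_pos_nonneg)
  define S where "S = disc_geodesic \<rho> a b u v ` {-q..r}"
  define T where "T = disc_geodesic \<rho> a b u' v' ` (if r \<le> s\<^sub>1 then {} else {s\<^sub>1..r})"
  define T' where "T' = disc_geodesic \<rho> a b u' v' ` (if q \<le> s\<^sub>2 then {} else {-q..-s\<^sub>2})"
  have sub: "S \<subseteq> hplane" "T \<subseteq> hplane" "T' \<subseteq> hplane"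
    unfolding S_def T_def T'_def using disc_geodesic_in_hplane[OF \<rho> b] uv by auto
  have "{\<omega> \<in> space M. S \<union> (T \<union> T') \<subseteq> Z \<omega>} \<in> events"
    using sub by (intro contains_set_event) auto
  moreover have "T \<union> T' \<subseteq> disc_geodesic \<rho> a b u' v' ` {-q..r}"
    using range_nonneg rq s unfolding T_def T'_def by (auto split: if_splits intro!: imageI)
  ultimately have "prob {\<omega> \<in> space M. S \<union> disc_geodesic \<rho> a b u' v' ` {-q..r} \<subseteq> Z \<omega>}
      \<le> prob {\<omega> \<in> space M. S \<union> (T \<union> T') \<subseteq> Z \<omega>}"
    by (intro finite_measure_mono) auto
  also have "\<dots> = prob {\<omega> \<in> space M. S \<subseteq> Z \<omega>} * prob {\<omega> \<in> space M. T \<union> T' \<subseteq> Z \<omega>}"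
  proof (rule prob_contains_union_far)
    fix x y assume "x \<in> S" "y \<in> T \<union> T'"
    then obtain t t' where t: "x = disc_geodesic \<rho> a b u v t" "y = disc_geodesic \<rho> a b u' v' t'"
      "\<not> r \<le> s\<^sub>1 \<and> s\<^sub>1 \<le> t' \<or> \<not> q \<le> s\<^sub>2 \<and> t' \<le> - s\<^sub>2"
      by (auto simp: S_def T_def T'_def split: if_splits)
    have "9 * cosh R \<le> \<bar>u - u'\<bar> * exp t' \<or> 9 * cosh R \<le> \<bar>v - v'\<bar> * exp (- t')"
      using t(3)
    proof (elim disjE conjE)
      assume "\<not> r \<le> s\<^sub>1" "s\<^sub>1 \<le> t'"
      then have "9 * cosh R \<le> \<bar>u - u'\<bar> * exp s\<^sub>1" "\<bar>u - u'\<bar> * exp s\<^sub>1 \<le> \<bar>u - u'\<bar> * exp t'"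
        using s\<^sub>1 by (auto intro!: mult_left_mono)
      then show ?thesis by linarith
    next
      assume "\<not> q \<le> s\<^sub>2" "t' \<le> - s\<^sub>2"
      then have "9 * cosh R \<le> \<bar>v - v'\<bar> * exp s\<^sub>2" "\<bar>v - v'\<bar> * exp s\<^sub>2 \<le> \<bar>v - v'\<bar> * exp (- t')"
        using s\<^sub>2 by (auto intro!: mult_left_mono)
      then show ?thesis by linarith
    qed
    then show "R \<le> hdist x y"
      unfolding t(1,2) by (rule hdist_disc_geodesic_far[OF \<rho> b u v range_nonneg])
  qed (use sub in auto)
  also have "prob {\<omega> \<in> space M. T \<union> T' \<subseteq> Z \<omega>} = prob {\<omega> \<in> space M. T \<subseteq> Z \<omega>} * prob {\<omega> \<in> space M. T' \<subseteq> Z \<omega>}"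
  proof (rule prob_contains_union_far)
    fix x y assume "x \<in> T" "y \<in> T'"
    then obtain t t' where t: "x = disc_geodesic \<rho> a b u' v' t" "y = disc_geodesic \<rho> a b u' v' t'" "s\<^sub>1 \<le> t" "t' \<le> - s\<^sub>2"
      by (auto simp: T_def T'_def split: if_splits)
    then have "hdist x y = \<bar>t - t'\<bar>"
      using geodesic_on_disc_geodesic[OF \<rho> b uv(2), of UNIV a] by (auto simp: geodesic_on_def)
    then show "R \<le> hdist x y" using t s by simp
  qed (use sub in auto)
  also have "prob {\<omega> \<in> space M. S \<subseteq> Z \<omega>} * (prob {\<omega> \<in> space M. T \<subseteq> Z \<omega>} * prob {\<omega> \<in> space M. T' \<subseteq> Z \<omega>})
      \<le> exp (- \<alpha> * (r + q)) * (exp (- \<alpha> * (r - s\<^sub>1)) * exp (- \<alpha> * (q - s\<^sub>2)))"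
  proof (intro mult_mono mult_nonneg_nonneg)
    show "prob {\<omega> \<in> space M. S \<subseteq> Z \<omega>} \<le> exp (- \<alpha> * (r + q))"
      using geodesic_segment_disc_geodesic[OF \<rho> b uv(1), of "-q" r a] rq by (intro segment_upper) (auto simp: S_def)
    show "prob {\<omega> \<in> space M. T \<subseteq> Z \<omega>} \<le> exp (- \<alpha> * (r - s\<^sub>1))"
    proof (cases "r \<le> s\<^sub>1")
      case True
      then have "0 \<le> - \<alpha> * (r - s\<^sub>1)"
        using exponent by (intro mult_nonpos_nonpos) auto
      then show ?thesis using one_le_exp_iff prob_le_1 order_trans by blast
    next
      case False
      then show ?thesis
        using geodesic_segment_disc_geodesic[OF \<rho> b uv(2), of s\<^sub>1 r a] by (intro segment_upper) (auto simp: T_def)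
    qed
    show "prob {\<omega> \<in> space M. T' \<subseteq> Z \<omega>} \<le> exp (- \<alpha> * (q - s\<^sub>2))"
    proof (cases "q \<le> s\<^sub>2")
      case True
      then have "0 \<le> - \<alpha> * (q - s\<^sub>2)"
        using exponent by (intro mult_nonpos_nonpos) auto
      then show ?thesis using one_le_exp_iff prob_le_1 order_trans by blast
    next
      case False
      then show ?thesis
        using geodesic_segment_disc_geodesic[OF \<rho> b uv(2), of "-q" "-s\<^sub>2" a] by (intro segment_upper) (auto simp: T'_def)
    qed
  qed auto
  also have "\<dots> = (exp (- \<alpha> * (r + q)))\<^sup>2 * exp (\<alpha> * s\<^sub>1) * exp (\<alpha> * s\<^sub>2)"
    by (simp add: power2_eq_square exp_add[symmetric] algebra_simps)
  finally show ?thesis by (simp add: S_def)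
qed

definition kernel_const :: real where
  "kernel_const = 2 * (18 * cosh R) powr \<alpha> / (1 - \<alpha>)"

text \<open>This is a lower bound for the quotient of the squared first moment and the second moment of the
number of surviving segments.\<close>

definition survival_const :: real where
  "survival_const = (c / kernel_const)\<^sup>2"

lemma kernel_const_pos: "0 < kernel_const"
  using exponent cosh_real_pos[of R] by (simp add: kernel_const_def)

lemma survival_const_pos: "0 < survival_const"
  using c_pos kernel_const_pos by (simp add: survival_const_def)

text \<open>The time \<open>s\<close> serves for distinct and for equal grid indices alike: the summand 1 in the denominator
costs a factor of at most 2 if the indices differ, and gives \<open>s \<ge> r\<close> if they agree. The factor 18 is
twice the 9 of \<open>hdist_disc_geodesic_far\<close>.\<close>

lemma separation_time:
  assumes "i < n" "i' < n" "exp r \<le> real n" and D: "\<bar>real i - real i'\<bar> / n \<le> D"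
  defines "s \<equiv> ln (18 * cosh R * n / (\<bar>real i - real i'\<bar> + 1))"
  shows "R \<le> s" and "r \<le> s \<or> 9 * cosh R \<le> D * exp s"
    and "exp (\<alpha> * s) = (18 * cosh R * n / (\<bar>real i - real i'\<bar> + 1)) powr \<alpha>"
proof -
  define k where "k = \<bar>real i - real i'\<bar>"
  have n: "0 < real n" and k: "0 \<le> k" "k + 1 \<le> real n" using assms(1,2) by (auto simp: k_def)
  define x where "x = 18 * cosh R * n / (k + 1)"
  have pos: "0 < x" unfolding x_def using n k cosh_real_pos[of R] by auto
  have exp_s: "exp s = x" unfolding s_def using pos by (simp add: x_def k_def)
  have "18 * cosh R * 1 \<le> 18 * cosh R * (n / (k + 1))"
    using k cosh_real_pos[of R] by (intro mult_left_mono) auto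
  then have "18 * cosh R \<le> x" by (simp add: x_def)
  moreover have "exp R \<le> 2 * cosh R" by (simp add: cosh_def)
  ultimately have "exp R \<le> exp s" unfolding exp_s using cosh_real_pos[of R] by linarith
  then show "R \<le> s" by simp
  show "r \<le> s \<or> 9 * cosh R \<le> D * exp s"
  proof (cases "i = i'")
    case True
    then have "x = 18 * cosh R * n" by (simp add: x_def k_def)
    moreover have "1 * real n \<le> 18 * cosh R * n"
      using cosh_real_ge_1[of R] by (intro mult_right_mono) auto
    ultimately have "n \<le> x" by simp
    then have "exp r \<le> exp s" using assms(3) exp_s by linarith
    then show ?thesis by simp
  next
    case False
    then have "1 \<le> k" unfolding k_def by linarith
    then have "1 / 2 \<le> k / (k + 1)" by (simp add: field_simps)
    then have "18 * cosh R * (1 / 2) \<le> 18 * cosh R * (k / (k + 1))"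
      using cosh_real_pos[of R] by (intro mult_left_mono) auto
    also have "\<dots> = k / n * x" using n by (simp add: x_def)
    also have "\<dots> \<le> D * x" using D pos by (intro mult_right_mono) (auto simp: k_def)
    finally show ?thesis by (simp add: exp_s)
  qed
  have "exp (\<alpha> * s) = exp s powr \<alpha>" by (simp add: exp_powr_real mult.commute)
  then show "exp (\<alpha> * s) = (18 * cosh R * n / (\<bar>real i - real i'\<bar> + 1)) powr \<alpha>"
    unfolding exp_s by (simp add: x_def k_def)
qed

text \<open>The constant does not depend on the lengths \<open>r\<close> and \<open>q\<close>, nor on the grid, because the kernel sums are
linear in \<open>n\<close> and \<open>m\<close> and cancel against the square of the first moment. It does not depend on the
position \<open>\<rho>\<close>, \<open>a\<close>, \<open>b\<close> of the family either, which the use of infinitely many copies needs.\<close>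

lemma some_grid_segment_survives:
  fixes V :: "nat \<Rightarrow> nat \<Rightarrow> real"
  assumes \<rho>: "cmod \<rho> = 1" and b: "0 < b" and rq: "0 \<le> r" "0 \<le> q"
    and n: "exp r \<le> real n" and m: "exp q \<le> real m"
    and V: "\<And>i j. i < n \<Longrightarrow> j < m \<Longrightarrow> V i j \<in> {0..2}"
    and spread: "\<And>i j i' j'. i < n \<Longrightarrow> j < m \<Longrightarrow> i' < n \<Longrightarrow> j' < m \<Longrightarrow>
      \<bar>real j - real j'\<bar> / m \<le> \<bar>V i j - V i' j'\<bar>"
  shows "survival_const \<le> prob (\<Union>(i, j)\<in>{..<n} \<times> {..<m}.
    {\<omega> \<in> space M. disc_geodesic \<rho> a b (i / n) (V i j) ` {-q..r} \<subseteq> Z \<omega>})"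
proof -
  define I where "I = {..<n} \<times> {..<m}"
  define E where "E x = {\<omega> \<in> space M. disc_geodesic \<rho> a b (fst x / n) (V (fst x) (snd x)) ` {-q..r} \<subseteq> Z \<omega>}"
    for x :: "nat \<times> nat"
  define p where "p = exp (- \<alpha> * (r + q))"
  define w where "w n i i' = (18 * cosh R * real n / (\<bar>real i - real i'\<bar> + 1)) powr \<alpha>" for n i i' :: nat
  have nm: "0 < real n" "0 < real m" using n m exp_gt_zero order_less_le_trans by blast+
  have p: "0 < p" by (simp add: p_def)
  have U: "i / n \<in> {0..1}" if "i < n" for i :: nat using that by auto
  have uv: "0 < 1 + i / n * V i j" if "i < n" "j < m" for i j
    using V[OF that] by (auto intro!: add_pos_nonneg)
  have ev: "E x \<in> events" if "x \<in> I" for x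
    unfolding E_def using that disc_geodesic_in_hplane[OF \<rho> b uv]
    by (intro contains_set_event) (auto simp: I_def)
  have "real (card I) * (c * p) \<le> (\<Sum>x\<in>I. prob (E x))"
  proof (rule sum_bounded_below)
    fix x assume x: "x \<in> I"
    have "geodesic_segment (r - - q) (disc_geodesic \<rho> a b (fst x / n) (V (fst x) (snd x)) ` {-q..r})"
      using x rq by (intro geodesic_segment_disc_geodesic \<rho> b uv) (auto simp: I_def)
    then show "c * p \<le> prob (E x)"
      using segment_lower[of "r + q"] rq by (auto simp: p_def E_def)
  qed
  moreover have "real (card I) = real n * real m" by (simp add: I_def)
  ultimately have first: "real n * real m * (c * p) \<le> (\<Sum>x\<in>I. prob (E x))" by simp
  have pair: "prob (E (i, j) \<inter> E (i', j')) \<le> p\<^sup>2 * w n i i' * w m j j'"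
    if ij: "i < n" "j < m" "i' < n" "j' < m" for i j i' j'
  proof -
    define s\<^sub>1 s\<^sub>2 where "s\<^sub>1 = ln (18 * cosh R * n / (\<bar>real i - real i'\<bar> + 1))"
      and "s\<^sub>2 = ln (18 * cosh R * m / (\<bar>real j - real j'\<bar> + 1))"
    have D: "\<bar>real i - real i'\<bar> / n \<le> \<bar>i / n - i' / n\<bar>"
      using nm by (simp add: diff_divide_distrib[symmetric])
    note 1 = separation_time[OF ij(1,3) n D, folded s\<^sub>1_def]
    note 2 = separation_time[OF ij(2,4) m spread[OF ij], folded s\<^sub>2_def]
    have "E (i, j) \<inter> E (i', j') = {\<omega> \<in> space M. disc_geodesic \<rho> a b (i / n) (V i j) ` {-q..r}
        \<union> disc_geodesic \<rho> a b (i' / n) (V i' j') ` {-q..r} \<subseteq> Z \<omega>}"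
      by (auto simp: E_def)
    also have "prob \<dots> \<le> (exp (- \<alpha> * (r + q)))\<^sup>2 * exp (\<alpha> * s\<^sub>1) * exp (\<alpha> * s\<^sub>2)"
      using 1 2 range_nonneg ij by (intro prob_two_segments_le \<rho> b U V rq) auto
    finally show ?thesis unfolding 1 2 p_def w_def .
  qed
  have row: "(\<Sum>y\<in>I. prob (E x \<inter> E y)) \<le> p\<^sup>2 * (kernel_const * n) * (kernel_const * m)" if x: "x \<in> I" for x
  proof -
    obtain i j where ij: "x = (i, j)" "i < n" "j < m" using x by (auto simp: I_def)
    have "(\<Sum>y\<in>I. prob (E x \<inter> E y)) = (\<Sum>i'<n. \<Sum>j'<m. prob (E (i, j) \<inter> E (i', j')))"
      unfolding I_def ij(1) by (simp add: sum.cartesian_product case_prod_unfold)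
    also have "\<dots> \<le> (\<Sum>i'<n. \<Sum>j'<m. p\<^sup>2 * w n i i' * w m j j')"
      using ij by (intro sum_mono pair) auto
    also have "\<dots> = p\<^sup>2 * (\<Sum>i'<n. w n i i') * (\<Sum>j'<m. w m j j')"
      by (simp add: sum_product sum_distrib_left sum_distrib_right mult_ac)
    also have "\<dots> \<le> p\<^sup>2 * (kernel_const * n) * (kernel_const * m)"
      unfolding w_def kernel_const_def using exponent ij(2,3) cosh_real_pos[of R]
      by (intro mult_mono sum_kernel_le sum_nonneg mult_nonneg_nonneg) auto
    finally show ?thesis .
  qed
  have "(\<Sum>x\<in>I. \<Sum>y\<in>I. prob (E x \<inter> E y)) \<le> real (card I) * (p\<^sup>2 * (kernel_const * n) * (kernel_const * m))"
    by (rule sum_bounded_above[OF row])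
  also have "\<dots> = (n * m * p * kernel_const)\<^sup>2"
    by (simp add: I_def power2_eq_square)
  finally have second: "(\<Sum>x\<in>I. \<Sum>y\<in>I. prob (E x \<inter> E y)) \<le> (n * m * p * kernel_const)\<^sup>2" .
  have "(real n * real m * (c * p))\<^sup>2 \<le> (\<Sum>x\<in>I. prob (E x))\<^sup>2"
    using first c_pos p by (intro power_mono) auto
  also have "\<dots> \<le> prob (\<Union>x\<in>I. E x) * (\<Sum>x\<in>I. \<Sum>y\<in>I. prob (E x \<inter> E y))"
    by (rule second_moment_method[OF _ ev]) (auto simp: I_def)
  also have "\<dots> \<le> prob (\<Union>x\<in>I. E x) * (n * m * p * kernel_const)\<^sup>2"
    by (intro mult_left_mono second) auto
  finally have "(c / kernel_const)\<^sup>2 \<le> prob (\<Union>x\<in>I. E x)"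
    using nm p kernel_const_pos by (simp add: power_mult_distrib power_divide field_simps)
  moreover have "(\<Union>x\<in>I. E x) = (\<Union>(i, j)\<in>{..<n} \<times> {..<m}.
      {\<omega> \<in> space M. disc_geodesic \<rho> a b (i / n) (V i j) ` {-q..r} \<subseteq> Z \<omega>})"
    by (simp add: I_def E_def case_prod_unfold)
  ultimately show ?thesis by (simp add: survival_const_def)
qed

text \<open>The events that a geodesic of the family survives up to time \<open>N\<close> decrease, and by compactness of
\<open>P\<close> their intersection is the event that a geodesic survives for all times.\<close>

lemma some_geodesic_survives:
  assumes P: "compact P" "P \<subseteq> {0..1} \<times> {0..2}" and J: "closed J"
    and \<rho>: "cmod \<rho> = 1" and b: "0 < b"
    and grid: "resolving_grids P J"
  shows "survival_const \<le> prob {\<omega> \<in> space M. \<exists>p\<in>P. \<forall>t\<in>J. disc_geodesic \<rho> a b (fst p) (snd p) t \<in> Z \<omega>}"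
proof -
  define E where "E N = {\<omega> \<in> space M. \<exists>p\<in>P. \<forall>t\<in>J \<inter> {- real N..real N}. disc_geodesic \<rho> a b (fst p) (snd p) t \<in> Z \<omega>}"
    for N :: nat
  have uv: "0 < 1 + u * v" if "(u, v) \<in> P" for u v
    using that P(2) by (auto intro!: add_pos_nonneg)
  have cont: "continuous_on (P \<times> J') (\<lambda>(p, t). disc_geodesic \<rho> a b (fst p) (snd p) t)" for J'
    by (rule continuous_on_disc_geodesic[OF b uv])
  have in_plane: "disc_geodesic \<rho> a b (fst p) (snd p) t \<in> hplane" if "p \<in> P" for p t
    using that uv[of "fst p" "snd p"] by (intro disc_geodesic_in_hplane \<rho> b) auto
  have ev: "E N \<in> events" for N
    unfolding E_def using J by (intro contains_curve_event P cont in_plane closed_Int) auto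
  have le: "survival_const \<le> prob (E N)" for N
  proof -
    obtain q r n m and V :: "nat \<Rightarrow> nat \<Rightarrow> real" where V: "J \<inter> {- real N..real N} = {-q..r}"
      "0 \<le> r" "0 \<le> q" "exp r \<le> real n" "exp q \<le> real m"
      "\<And>i j. i < n \<Longrightarrow> j < m \<Longrightarrow> (i / n, V i j) \<in> P"
      "\<And>i j i' j'. i < n \<Longrightarrow> j < m \<Longrightarrow> i' < n \<Longrightarrow> j' < m \<Longrightarrow> \<bar>real j - real j'\<bar> / m \<le> \<bar>V i j - V i' j'\<bar>"
      using grid[unfolded resolving_grids_def, rule_format, of N] by metis
    have "survival_const \<le> prob (\<Union>(i, j)\<in>{..<n} \<times> {..<m}.
        {\<omega> \<in> space M. disc_geodesic \<rho> a b (i / n) (V i j) ` {-q..r} \<subseteq> Z \<omega>})"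
    proof (rule some_grid_segment_survives[OF \<rho> b V(2-5) _ V(7)])
      show "V i j \<in> {0..2}" if "i < n" "j < m" for i j
        using V(6)[OF that] P(2) by auto
    qed
    also have "\<dots> \<le> prob (E N)"
    proof (rule finite_measure_mono[OF _ ev], clarsimp)
      fix \<omega> i j assume "i < n" "j < m" "\<omega> \<in> space M" "disc_geodesic \<rho> a b (i / n) (V i j) ` {-q..r} \<subseteq> Z \<omega>"
      then show "\<omega> \<in> E N"
        unfolding E_def V(1) using V(6)[of i j] by (auto intro!: bexI[of _ "(i / n, V i j)"])
    qed
    finally show ?thesis .
  qed
  have "decseq E"
  proof (rule decseq_SucI, rule subsetI)
    fix N \<omega> assume "\<omega> \<in> E (Suc N)"
    then obtain p where p: "\<omega> \<in> space M" "p \<in> P"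
      "\<And>t. t \<in> J \<inter> {- real (Suc N)..real (Suc N)} \<Longrightarrow> disc_geodesic \<rho> a b (fst p) (snd p) t \<in> Z \<omega>"
      by (auto simp: E_def)
    then show "\<omega> \<in> E N" unfolding E_def by (auto intro!: bexI[of _ p])
  qed
  then have "(\<lambda>N. prob (E N)) \<longlonglongrightarrow> prob (\<Inter>N. E N)"
    using ev by (intro finite_Lim_measure_decseq) auto
  then have "survival_const \<le> prob (\<Inter>N. E N)"
    by (rule LIMSEQ_le_const) (use le in auto)
  also have "(\<Inter>N. E N) = {\<omega> \<in> space M. \<exists>p\<in>P. \<forall>t\<in>J. disc_geodesic \<rho> a b (fst p) (snd p) t \<in> Z \<omega>}"
  proof (intro equalityI subsetI)
    fix \<omega> assume \<omega>: "\<omega> \<in> (\<Inter>N. E N)"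
    then have "\<omega> \<in> space M" by (auto simp: E_def)
    moreover have "\<exists>p\<in>P. \<forall>t\<in>J. disc_geodesic \<rho> a b (fst p) (snd p) t \<in> Z \<omega>"
      by (rule curve_exhaustion[OF P(1) cont in_plane Z_closed]) (use \<omega> in \<open>auto simp: E_def\<close>)
    ultimately show "\<omega> \<in> {\<omega> \<in> space M. \<exists>p\<in>P. \<forall>t\<in>J. disc_geodesic \<rho> a b (fst p) (snd p) t \<in> Z \<omega>}" by simp
  qed (auto simp: E_def)
  finally show ?thesis .
qed

end

section \<open>Geodesics in well-behaved percolation\<close>

context finite_range_with_decay
begin

text \<open>The copies differ by horocyclic translations \<open>z \<mapsto> z + a\<close>. These fix \<open>\<infinity>\<close>, so the copies of lines
with the ideal endpoint \<open>\<rho>\<close> have that endpoint as well.\<close>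

lemma almost_surely_copy_survives:
  assumes P: "compact P" "P \<subseteq> {0..1} \<times> {0..2}" and J: "closed J" and \<rho>: "cmod \<rho> = 1"
    and bounded: "\<And>u v t. (u, v) \<in> P \<Longrightarrow> t \<in> J \<Longrightarrow> \<bar>Re (uhp_geodesic u v t)\<bar> \<le> 2 \<and> Im (uhp_geodesic u v t) \<le> 2"
    and grid: "resolving_grids P J"
  shows "AE \<omega> in M. \<exists>a. \<exists>(u, v)\<in>P. \<forall>t\<in>J. disc_geodesic \<rho> a 1 u v t \<in> Z \<omega>"
proof -
  \<comment> \<open>the translation length for which \<open>hdist_translates_far\<close> separates the copies\<close>
  define d where "d = 8 * cosh R + 4"
  have d: "0 < d" using cosh_real_pos[of R] by (auto simp: d_def intro!: add_pos_pos)
  have uv: "0 < 1 + u * v" if "(u, v) \<in> P" for u v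
    using that P(2) by (auto intro!: add_pos_nonneg)
  have "AE \<omega> in M. \<exists>k::nat. \<exists>p\<in>P. \<forall>t\<in>J. disc_geodesic \<rho> (k * d) 1 (fst p) (snd p) t \<in> Z \<omega>"
  proof (rule independent_copies[OF P(1) J _ _ _ survival_const_pos])
    show "continuous_on (P \<times> J) (\<lambda>(p, t). disc_geodesic \<rho> (k * d) 1 (fst p) (snd p) t)" for k :: nat
      by (rule continuous_on_disc_geodesic[OF _ uv]) auto
    show "disc_geodesic \<rho> (k * d) 1 (fst p) (snd p) t \<in> hplane" if "p \<in> P" for p t and k :: nat
      using that uv[of "fst p" "snd p"] by (intro disc_geodesic_in_hplane \<rho>) auto
    fix j k :: nat and p t p' t' assume *: "j < k" "p \<in> P" "t \<in> J" "p' \<in> P" "t' \<in> J"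
    have "1 * d \<le> real (k - j) * d" using *(1) d by (intro mult_right_mono) auto
    then have far: "d \<le> \<bar>j * d - k * d\<bar>"
      using *(1) by (simp add: of_nat_diff left_diff_distrib)
    show "R \<le> hdist (disc_geodesic \<rho> (j * d) 1 (fst p) (snd p) t) (disc_geodesic \<rho> (k * d) 1 (fst p') (snd p') t')"
      using * bounded[of "fst p" "snd p" t] bounded[of "fst p'" "snd p'" t'] uv far
      by (intro hdist_translates_far \<rho> range_nonneg) (auto simp: d_def)
  next
    show "survival_const \<le> prob {\<omega> \<in> space M. \<exists>p\<in>P. \<forall>t\<in>J. disc_geodesic \<rho> (k * d) 1 (fst p) (snd p) t \<in> Z \<omega>}" for k :: nat
      by (rule some_geodesic_survives[OF P J \<rho> zero_less_one grid])
  qed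
  then show ?thesis by (rule AE_mp) (auto intro!: AE_I2 bexI simp: case_prod_unfold)
qed

text \<open>The family consists of semicircles with endpoints in \<open>[-1, -1/2]\<close> and \<open>[0, 1]\<close>. Both endpoints
range over an interval away from \<open>\<infinity>\<close>, so the lines stay in a bounded region of the half-plane.\<close>

lemma almost_surely_line: "AE \<omega> in M. \<exists>L. geodesic_line L \<and> L \<subseteq> Z \<omega>"
proof -
  have "AE \<omega> in M. \<exists>a. \<exists>(u, v)\<in>{0..1} \<times> {1..2}. \<forall>t\<in>UNIV. disc_geodesic 1 a 1 u v t \<in> Z \<omega>"
  proof (rule almost_surely_copy_survives)
    show "compact ({0..1} \<times> {1..2 :: real} :: (real \<times> real) set)" by (intro compact_Times) auto
    fix u v t :: real assume "(u, v) \<in> {0..1} \<times> {1..2}"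
    then show "\<bar>Re (uhp_geodesic u v t)\<bar> \<le> 2 \<and> Im (uhp_geodesic u v t) \<le> 2"
      using uhp_geodesic_bounded_two_parameter by auto
  qed (use two_parameter_grid in auto)
  then show ?thesis
  proof (rule AE_mp, intro AE_I2 impI)
    fix \<omega> assume "\<exists>a. \<exists>(u, v)\<in>{0..1} \<times> {1..2}. \<forall>t\<in>UNIV. disc_geodesic 1 a 1 u v t \<in> Z \<omega>"
    then obtain a u v where uv: "u \<in> {0..1}" "v \<in> {1..2}" "range (disc_geodesic 1 a 1 u v) \<subseteq> Z \<omega>" by blast
    then have "geodesic_on UNIV (disc_geodesic 1 a 1 u v)"
      by (intro geodesic_on_disc_geodesic) (auto intro!: add_pos_nonneg)
    then show "\<exists>L. geodesic_line L \<and> L \<subseteq> Z \<omega>"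
      unfolding geodesic_line_def using uv(3) by blast
  qed
qed

text \<open>In the upper half-plane the curves are vertical half-lines that start at height 1 and run down to the
real axis; the lines that extend them have \<open>\<infinity>\<close>, which corresponds to \<open>x\<close>, as the other endpoint.\<close>

lemma almost_surely_half_line_through_ideal:
  assumes x: "cmod x = 1"
  shows "AE \<omega> in M. \<exists>L. line_through_ideal L x \<and> (\<exists>H. half_line H \<and> H \<subseteq> L \<inter> Z \<omega>)"
proof -
  have "AE \<omega> in M. \<exists>a. \<exists>(u, v)\<in>{0..1} \<times> {0}. \<forall>t\<in>{0..}. disc_geodesic x a 1 u v t \<in> Z \<omega>"
  proof (rule almost_surely_copy_survives[OF _ _ _ x])
    show "compact ({0..1} \<times> {0} :: (real \<times> real) set)" by (intro compact_Times) auto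
    fix u v t :: real assume "(u, v) \<in> {0..1} \<times> {0}" "t \<in> {0..}"
    then show "\<bar>Re (uhp_geodesic u v t)\<bar> \<le> 2 \<and> Im (uhp_geodesic u v t) \<le> 2"
      using uhp_geodesic_bounded_one_parameter by auto
  next
    show "resolving_grids ({0..1} \<times> {0}) {0..}"
      by (rule one_parameter_grid[where f = "\<lambda>_. 0"]) auto
  qed auto
  then show ?thesis
  proof (rule AE_mp, intro AE_I2 impI)
    fix \<omega> assume "\<exists>a. \<exists>(u, v)\<in>{0..1} \<times> {0}. \<forall>t\<in>{0..}. disc_geodesic x a 1 u v t \<in> Z \<omega>"
    then obtain a u where u: "disc_geodesic x a 1 u 0 ` {0..} \<subseteq> Z \<omega>" by auto
    have "geodesic_on I (disc_geodesic x a 1 u 0)" for I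
      by (intro geodesic_on_disc_geodesic x) auto
    then have "line_through_ideal (range (disc_geodesic x a 1 u 0)) x" "half_line (disc_geodesic x a 1 u 0 ` {0..})"
      unfolding line_through_ideal_def half_line_def using disc_geodesic_tendsto_ideal_point by blast+
    then show "\<exists>L. line_through_ideal L x \<and> (\<exists>H. half_line H \<and> H \<subseteq> L \<inter> Z \<omega>)"
      using u by blast
  qed
qed

text \<open>A set that is not an event has measure 0 by convention, so a lower bound for the probability of a
smaller event says something about this set only because it is an event.\<close>

lemma half_line_through_event:
  assumes "x \<in> hplane"
  shows "{\<omega> \<in> space M. \<exists>H. half_line H \<and> x \<in> H \<and> H \<subseteq> Z \<omega>} \<in> events"
proof -
  obtain a b where b: "0 < b" and x: "disc_affine a b 0 = x" using disc_affine_transitive[OF assms] .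
  have plane: "radial \<theta> t \<in> hplane" if "\<theta> \<in> sphere 0 1" for \<theta> t
    using radial_geodesic[of \<theta> UNIV] that by (auto simp: geodesic_on_def)
  have "{\<omega> \<in> space M. \<exists>\<theta>\<in>sphere 0 1. \<forall>t\<in>{0..}. disc_affine a b (radial \<theta> t) \<in> Z \<omega>} \<in> events"
  proof (rule contains_curve_event)
    have "continuous_on (sphere 0 1 \<times> {0..}) (\<lambda>(\<theta>, t). radial \<theta> t)"
      unfolding radial_def case_prod_unfold by (intro continuous_intros) auto
    then have "continuous_on (sphere 0 1 \<times> {0..}) (\<lambda>y. disc_affine a b ((\<lambda>(\<theta>, t). radial \<theta> t) y))"
      by (rule continuous_on_compose2[OF continuous_on_disc_affine[OF b]]) (auto intro!: plane)
    then show "continuous_on (sphere 0 1 \<times> {0..}) (\<lambda>(\<theta>, t). disc_affine a b (radial \<theta> t))"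
      by (simp add: case_prod_unfold)
  qed (auto intro!: disc_affine_in_hplane b plane)
  then show ?thesis
    unfolding half_line_through_radial_iff[OF b, of a, unfolded x] .
qed

text \<open>For \<open>v = u\<close> the Moebius map is a rotation about \<open>\<i>\<close>, so all curves of this family start
at the same point, and \<open>a\<close> and \<open>b\<close> move it to \<open>x\<close>.\<close>

lemma half_line_through_point_pos:
  assumes "x \<in> hplane"
  shows "0 < prob {\<omega> \<in> space M. \<exists>H. half_line H \<and> x \<in> H \<and> H \<subseteq> Z \<omega>}"
proof -
  obtain a b where b: "0 < b" and x: "disc_affine a b 0 = x" using disc_affine_transitive[OF assms] .
  define P where "P = (\<lambda>u. (u, u)) ` {0..1 :: real}"
  have "survival_const \<le> prob {\<omega> \<in> space M. \<exists>p\<in>P. \<forall>t\<in>{0..}. disc_geodesic 1 a b (fst p) (snd p) t \<in> Z \<omega>}"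
  proof (rule some_geodesic_survives[OF _ _ _ _ b])
    show "compact P" unfolding P_def by (intro compact_continuous_image continuous_intros) auto
    show "P \<subseteq> {0..1} \<times> {0..2}" by (auto simp: P_def)
    show "resolving_grids P {0..}"
      by (rule one_parameter_grid[where f = "\<lambda>u. u"]) (auto simp: P_def)
  qed auto
  also have "\<dots> \<le> prob {\<omega> \<in> space M. \<exists>H. half_line H \<and> x \<in> H \<and> H \<subseteq> Z \<omega>}"
  proof (rule finite_measure_mono[OF subsetI half_line_through_event[OF assms]])
    fix \<omega> assume "\<omega> \<in> {\<omega> \<in> space M. \<exists>p\<in>P. \<forall>t\<in>{0..}. disc_geodesic 1 a b (fst p) (snd p) t \<in> Z \<omega>}"
    then obtain u where \<omega>: "\<omega> \<in> space M" and Z: "\<And>t. 0 \<le> t \<Longrightarrow> disc_geodesic 1 a b u u t \<in> Z \<omega>"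
      by (auto simp: P_def)
    have u: "0 < 1 + u * u" by (intro add_pos_nonneg) auto
    have "Complex u 1 = \<i> * Complex 1 (- u)" by (simp add: complex_eq_iff)
    then have "uhp_geodesic u u 0 = \<i>" by (simp add: uhp_geodesic_def uhp_geodesic_denom_nonzero)
    then have start: "disc_geodesic 1 a b u u 0 = x"
      by (simp add: disc_geodesic_def disc_affine_def cayley_inv_def x[symmetric])
    have "half_line (disc_geodesic 1 a b u u ` {0..})"
      unfolding half_line_def using geodesic_on_disc_geodesic[of 1 b u u "{0..}" a] b u by auto
    moreover have "x \<in> disc_geodesic 1 a b u u ` {0..}" using start by (auto intro: image_eqI[of _ _ 0])
    ultimately show "\<omega> \<in> {\<omega> \<in> space M. \<exists>H. half_line H \<and> x \<in> H \<and> H \<subseteq> Z \<omega>}"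
      using Z \<omega> by blast
  qed
  finally show ?thesis using survival_const_pos by linarith
qed

end

lemma well_behaved_finite_range_with_decay:
  assumes "well_behaved_percolation M Z b" and "decay_exponent M Z \<alpha>" and "\<alpha> < 1"
  obtains R c where "finite_range_with_decay M Z R \<alpha> c"
proof -
  interpret well_behaved_percolation M Z b by fact
  obtain R0 :: real where R0: "\<And>A A'. A \<subseteq> hplane \<Longrightarrow> A' \<subseteq> hplane \<Longrightarrow> (\<forall>a\<in>A. \<forall>a'\<in>A'. R0 \<le> hdist a a') \<Longrightarrow>
      indep_var (closed_sets A) (\<lambda>\<omega>. Z \<omega> \<inter> A) (closed_sets A') (\<lambda>\<omega>. Z \<omega> \<inter> A')"
    using finite_range_dependence by blast
  obtain c where c: "0 \<le> \<alpha>" "0 < c" "\<And>r S. 0 \<le> r \<Longrightarrow> geodesic_segment r S \<Longrightarrow>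
      c * exp (- \<alpha> * r) \<le> prob {\<omega> \<in> space M. S \<subseteq> Z \<omega>} \<and> prob {\<omega> \<in> space M. S \<subseteq> Z \<omega>} \<le> exp (- \<alpha> * r)"
    using assms(2) unfolding decay_exponent_def by blast
  have "finite_range_with_decay M Z (max 0 R0) \<alpha> c"
    by unfold_locales (use c assms(3) random_closed_set in \<open>auto intro!: R0\<close>)
  then show ?thesis by (rule that)
qed

theorem lemma3p5:
  fixes M :: "'w measure" and Z :: "'w \<Rightarrow> complex set" and b :: complex and \<alpha> :: real
  assumes "well_behaved_percolation M Z b"
    and "decay_exponent M Z \<alpha>"
    and "\<alpha> < 1"
  shows "(AE \<omega> in M. \<exists>L. geodesic_line L \<and> L \<subseteq> Z \<omega>) \<and>
    (\<forall>x\<in>hplane. 0 < measure M {\<omega> \<in> space M. \<exists>H. half_line H \<and> x \<in> H \<and> H \<subseteq> Z \<omega>}) \<and>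
    (\<forall>x\<in>ideal_boundary. AE \<omega> in M.
       \<exists>L. line_through_ideal L x \<and> (\<exists>H. half_line H \<and> H \<subseteq> L \<inter> Z \<omega>))"
proof -
  obtain R c where "finite_range_with_decay M Z R \<alpha> c"
    using well_behaved_finite_range_with_decay[OF assms] .
  then interpret finite_range_with_decay M Z R \<alpha> c .
  show ?thesis
    using almost_surely_line half_line_through_point_pos almost_surely_half_line_through_ideal
    by (simp add: ideal_boundary_def)
qed

end
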